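(* Let $\mathbb{L}=TS^2$ be the space of oriented affine lines in $\mathbb{R}^3$ with its neutral Kähler metric $\mathbb{G}$ associated with the round metric on $S^2$. A rotationally symmetric surface in $\mathbb{L}$ which is given by the graph of a local section $\xi\mapsto(\xi,\eta=F(\xi,\bar\xi))$ is area-stationary with respect to $\mathbb{G}$ if and only if $$F=\left[A_1R+B_1R^{-1}(1+R^2)^2\pm i\left[A_2R^2+B_2(1+R^2)^2-B_1^2R^{-2}(1+R^2)^4\right]^{\frac12}\right]e^{i\theta}$$ for $A_1,A_2,B_1,B_2\in\mathbb{R}$, $A_2\neq0$, where $\xi=Re^{i\theta}$ and $g=e^{2u}d\xi d\bar\xi$ for $u=u(R)$.
   Context: The space $\mathbb{L}$ of oriented affine lines in $\mathbb{R}^3$ is identified with $TS^2$. On $S^2$ take the holomorphic coordinate $\xi$ in which the round metric is $g=e^{2u}d\xi d\bar\xi$ with $e^{2u}=4(1+\xi\bar\xi)^{-2}$. Coordinates $(\xi,\eta)$ on $TS^2$ are given by identifying $(\xi,\eta)$ with $\eta\frac{\partial}{\partial\xi}+\bar\eta\frac{\partial}{\partial\bar\xi}\in T_\xi S^2$. The neutral Kähler metric is $\mathbb{G}=2\,\mathrm{Im}\left(e^{2u}d\bar\eta\, d\xi-\eta\,\partial(e^{2u})\,d\xi d\bar\xi\right)$, with $\partial=\partial/\partial\xi$. A surface in $TS^2$ is rotationally symmetric if it is invariant under the isometries $(\xi,\eta)\mapsto(\xi e^{iC},\eta e^{iC})$ of $\mathbb{G}$; for a graph this means $F(\xi,\bar\xi)=G(R)e^{i\theta}$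 for some complex-valued function $G$. For the graph of a local section put $\sigma=-\partial\bar F$, $\rho=e^{-2u}\partial(Fe^{2u})$, $\lambda=\mathrm{Im}\,\rho$. The metric induced on the graph by $\mathbb{G}$ has determinant $(\lambda^2-\sigma\bar\sigma)e^{4u}$ in the coordinates $(\xi,\bar\xi)$, and the area functional on the graph is $A(F)=\int|\lambda^2-\sigma\bar\sigma|^{1/2}e^{2u}\,d\xi d\bar\xi$. The graph is area-stationary if the first variation satisfies $\delta A(F)=0$ for all variations $\delta F$ of $F$.
   Formalization: The graph (over a connected domain) is assumed to have nondegenerate induced metric; otherwise the claim fails: F=i[R²+(1+R²)²]^{1/2}e^{iθ} on an annulus containing R=1 has the stated form but is not area-stationary. *)

theory Defs
  imports "HOL-Analysis.Analysis"
begin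

section \<open>Smooth functions and the Wirtinger derivative\<close>

text \<open>\<open>f\<close> is of class \<open>C\<^sup>k\<close>, in the real sense, on the open set \<open>U\<close>.\<close>

primrec Ck_on :: "nat \<Rightarrow> (complex \<Rightarrow> complex) \<Rightarrow> complex set \<Rightarrow> bool" where
  "Ck_on 0 f U \<longleftrightarrow> continuous_on U f"
| "Ck_on (Suc k) f U \<longleftrightarrow> (\<forall>z\<in>U. f differentiable (at z)) \<and>
     (\<forall>v. Ck_on k (\<lambda>z. frechet_derivative f (at z) v) U)"

definition smooth_on :: "(complex \<Rightarrow> complex) \<Rightarrow> complex set \<Rightarrow> bool" where
  "smooth_on f U \<longleftrightarrow> (\<forall>k. Ck_on k f U)"

text \<open>\<open>\<partial> f / \<partial>\<xi> = (f\<^sub>x - \<i> f\<^sub>y) / 2\<close> for \<open>\<xi> = x + \<i> y\<close>.\<close>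

definition wirt :: "(complex \<Rightarrow> complex) \<Rightarrow> complex \<Rightarrow> complex" where
  "wirt f \<xi> = (frechet_derivative f (at \<xi>) 1 - \<i> * frechet_derivative f (at \<xi>) \<i>) / 2"


section \<open>The neutral metric on the space of oriented lines\<close>

text \<open>
  The sphere is covered, up to one point, by the coordinate \<open>\<xi>\<close>, and a tangent vector
  \<open>\<eta> \<partial>/\<partial>\<xi> + c.c.\<close> at \<open>\<xi>\<close> is represented by the pair \<open>(\<xi>, \<eta>)\<close>.
  \<open>e2u\<close> is the conformal factor \<open>e\<^bsup>2u\<^esup>\<close> of the round metric \<open>e\<^bsup>2u\<^esup> d\<xi> d\<xi>\<^sup>-\<close>.
\<close>

definition e2u :: "complex \<Rightarrow> real" where
  "e2u \<xi> = 4 / (1 + (cmod \<xi>)\<^sup>2)\<^sup>2"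

text \<open>
  The symmetric bilinear form obtained by polarizing the quadratic form
  \<open>2 Im (e\<^bsup>2u\<^esup> d\<eta>\<^sup>- d\<xi> - \<eta> \<partial>(e\<^bsup>2u\<^esup>) d\<xi> d\<xi>\<^sup>-)\<close> (a superscript minus denotes the conjugate).
  A tangent vector \<open>(v, w)\<close> has \<open>d\<xi>\<close>-component \<open>v\<close> and \<open>d\<eta>\<close>-component \<open>w\<close>.
\<close>

definition neutral_metric ::
    "complex \<times> complex \<Rightarrow> complex \<times> complex \<Rightarrow> complex \<times> complex \<Rightarrow> real" where
  "neutral_metric p X Y =
     (case (p, X, Y) of ((\<xi>, \<eta>), (v, w), (v', w')) \<Rightarrow>
        Im (complex_of_real (e2u \<xi>) * (cnj w * v' + cnj w' * v)
            - \<eta> * wirt (\<lambda>z. complex_of_real (e2u z)) \<xi> * (v * cnj v' + v' * cnj v)))"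

definition graph :: "(complex \<Rightarrow> complex) \<Rightarrow> complex set \<Rightarrow> (complex \<times> complex) set" where
  "graph F U = (\<lambda>\<xi>. (\<xi>, F \<xi>)) ` U"

definition rotation :: "real \<Rightarrow> complex \<times> complex \<Rightarrow> complex \<times> complex" where
  "rotation C = (\<lambda>(\<xi>, \<eta>). (\<xi> * cis C, \<eta> * cis C))"

definition rotationally_symmetric :: "(complex \<times> complex) set \<Rightarrow> bool" where
  "rotationally_symmetric S \<longleftrightarrow> (\<forall>C. rotation C ` S = S)"

definition induced_metric ::
    "(complex \<Rightarrow> complex) \<Rightarrow> complex \<Rightarrow> complex \<Rightarrow> complex \<Rightarrow> real" where
  "induced_metric F \<xi> a b =
     neutral_metric (\<xi>, F \<xi>) (a, frechet_derivative F (at \<xi>) a) (b, frechet_derivative F (at \<xi>) b)"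

text \<open>The Gram determinant in the real coordinates \<open>x, y\<close> with \<open>\<xi> = x + \<i> y\<close>.\<close>

definition induced_det :: "(complex \<Rightarrow> complex) \<Rightarrow> complex \<Rightarrow> real" where
  "induced_det F \<xi> =
     induced_metric F \<xi> 1 1 * induced_metric F \<xi> \<i> \<i> - (induced_metric F \<xi> 1 \<i>)\<^sup>2"

definition nondegenerate_graph :: "(complex \<Rightarrow> complex) \<Rightarrow> complex set \<Rightarrow> bool" where
  "nondegenerate_graph F U \<longleftrightarrow> (\<forall>\<xi>\<in>U. induced_det F \<xi> \<noteq> 0)"


section \<open>The area functional and area-stationary graphs\<close>

definition shear :: "(complex \<Rightarrow> complex) \<Rightarrow> complex \<Rightarrow> complex" where
  "shear F \<xi> = - wirt (\<lambda>z. cnj (F z)) \<xi>"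

definition rho :: "(complex \<Rightarrow> complex) \<Rightarrow> complex \<Rightarrow> complex" where
  "rho F \<xi> = wirt (\<lambda>z. F z * complex_of_real (e2u z)) \<xi> / complex_of_real (e2u \<xi>)"

definition twist :: "(complex \<Rightarrow> complex) \<Rightarrow> complex \<Rightarrow> real" where
  "twist F \<xi> = Im (rho F \<xi>)"

text \<open>The area of the part of the graph over \<open>K\<close>; the factor 2 comes from \<open>|d\<xi> d\<xi>\<^sup>-| = 2 dx dy\<close>.\<close>

definition area :: "(complex \<Rightarrow> complex) \<Rightarrow> complex set \<Rightarrow> real" where
  "area F K =
     (LINT \<xi>:K|lborel. sqrt \<bar>(twist F \<xi>)\<^sup>2 - (cmod (shear F \<xi>))\<^sup>2\<bar> * e2u \<xi> * 2)"

text \<open>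
  Since \<open>U\<close> is not compact and the area over \<open>U\<close> may be infinite, variations are
  compactly supported and the area is taken over a compact set containing the support.
  Where the induced metric degenerates the integrand is not differentiable in \<open>t\<close>.
\<close>

definition area_stationary :: "(complex \<Rightarrow> complex) \<Rightarrow> complex set \<Rightarrow> bool" where
  "area_stationary F U \<longleftrightarrow>
     (\<forall>\<phi> K. smooth_on \<phi> UNIV \<and> compact K \<and> K \<subseteq> U \<and> (\<forall>z. z \<notin> K \<longrightarrow> \<phi> z = 0) \<longrightarrow>
        ((\<lambda>t::real. area (\<lambda>z. F z + complex_of_real t * \<phi> z) K) has_real_derivative 0) (at 0))"

text \<open>
  The area density above is the one of the metric induced by the neutral metric:
  passing from \<open>(\<xi>, \<xi>\<^sup>-)\<close> to \<open>(x, y)\<close> multiplies the determinant by 4 in absolute value.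
\<close>

lemma e2u_differentiable: "(\<lambda>z. complex_of_real (e2u z)) differentiable (at \<xi>)"
proof -
  have "1 + (Re z)\<^sup>2 + (Im z)\<^sup>2 \<noteq> 0" for z :: complex
    by (metis add.assoc add_pos_nonneg less_numeral_extra(1) less_numeral_extra(3) sum_power2_ge_zero)
  hence nz: "(1 + (Re z)\<^sup>2 + (Im z)\<^sup>2)\<^sup>2 \<noteq> 0" for z :: complex
    by simp
  have eq: "(\<lambda>z. complex_of_real (e2u z)) =
      (\<lambda>z. complex_of_real (4 / (1 + (Re z)\<^sup>2 + (Im z)\<^sup>2)\<^sup>2))"
    by (simp add: e2u_def cmod_power2 add.assoc)
  have d: "((\<lambda>z. (1 + (Re z)\<^sup>2 + (Im z)\<^sup>2)\<^sup>2) has_derivative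
      (\<lambda>h. 2 * (2 * Re h * Re \<xi> + 2 * Im h * Im \<xi>) * (1 + (Re \<xi>)\<^sup>2 + (Im \<xi>)\<^sup>2))) (at \<xi>)"
    by (auto intro!: derivative_eq_intros simp: algebra_simps)
  have "(\<lambda>z. 4 / (1 + (Re z)\<^sup>2 + (Im z)\<^sup>2)\<^sup>2) differentiable (at \<xi>)"
    by (rule differentiable_divide[OF differentiable_const differentiableI[OF d] nz])
  then obtain D where "((\<lambda>z. 4 / (1 + (Re z)\<^sup>2 + (Im z)\<^sup>2)\<^sup>2) has_derivative D) (at \<xi>)"
    by (auto simp: differentiable_def)
  hence "((\<lambda>z. complex_of_real (4 / (1 + (Re z)\<^sup>2 + (Im z)\<^sup>2)\<^sup>2)) has_derivative
      (\<lambda>h. complex_of_real (D h))) (at \<xi>)"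
    by (rule has_derivative_of_real)
  thus ?thesis
    unfolding eq by (rule differentiableI)
qed

lemma induced_det_eq:
  assumes "F differentiable (at \<xi>)"
  shows "induced_det F \<xi> = 4 * ((twist F \<xi>)\<^sup>2 - (cmod (shear F \<xi>))\<^sup>2) * (e2u \<xi>)\<^sup>2"
proof -
  define E where "E = (\<lambda>z. complex_of_real (e2u z))"
  define a where "a = frechet_derivative F (at \<xi>) 1"
  define b where "b = frechet_derivative F (at \<xi>) \<i>"
  have dF: "(F has_derivative frechet_derivative F (at \<xi>)) (at \<xi>)"
    using assms by (simp add: frechet_derivative_works)
  have dE: "(E has_derivative frechet_derivative E (at \<xi>)) (at \<xi>)"
    using e2u_differentiable by (simp add: frechet_derivative_works E_def)
  have "((\<lambda>z. cnj (F z)) has_derivative (\<lambda>h. cnj (frechet_derivative F (at \<xi>) h))) (at \<xi>)"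
    by (rule has_derivative_cnj[OF dF])
  hence sh: "shear F \<xi> = - (cnj a - \<i> * cnj b) / 2"
    by (simp add: shear_def wirt_def frechet_derivative_at[symmetric] a_def b_def minus_divide_left)
  have "((\<lambda>z. F z * E z) has_derivative (\<lambda>h. F \<xi> * frechet_derivative E (at \<xi>) h
           + frechet_derivative F (at \<xi>) h * E \<xi>)) (at \<xi>)"
    by (rule has_derivative_mult[OF dF dE])
  hence wr: "wirt (\<lambda>z. F z * E z) \<xi> = F \<xi> * wirt E \<xi> + (a - \<i> * b) / 2 * E \<xi>"
    by (simp add: wirt_def frechet_derivative_at[symmetric] a_def b_def field_simps)
  define e where "e = e2u \<xi>"
  have Exi: "E \<xi> = complex_of_real e"
    by (simp add: E_def e_def)
  have "1 + (cmod \<xi>)\<^sup>2 \<noteq> 0"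
    by (metis add_pos_nonneg less_numeral_extra(1) less_numeral_extra(3) zero_le_power2)
  hence e0: "e \<noteq> 0"
    by (simp add: e_def e2u_def)
  define P where "P = F \<xi> * wirt E \<xi>"
  have r: "rho F \<xi> = (P + (a - \<i> * b) / 2 * complex_of_real e) / complex_of_real e"
    using wr unfolding rho_def P_def by (simp add: E_def e_def)
  have tw: "twist F \<xi> * e = Im P + (Im a - Re b) / 2 * e"
    using e0 by (simp add: twist_def r)
  have m: "induced_metric F \<xi> 1 1 = - 2 * e * Im a - 2 * Im P"
    "induced_metric F \<xi> \<i> \<i> = 2 * e * Re b - 2 * Im P"
    "induced_metric F \<xi> 1 \<i> = e * (Re a - Im b)"
    by (simp_all add: induced_metric_def neutral_metric_def algebra_simps
        flip: a_def b_def E_def e_def) (simp_all add: P_def algebra_simps)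
  have "induced_det F \<xi> = 4 * (e * Im a + Im P) * (Im P - e * Re b) - (e * (Re a - Im b))\<^sup>2"
    by (simp add: induced_det_def m algebra_simps power2_eq_square)
  also have "\<dots> = 4 * ((twist F \<xi> * e)\<^sup>2 - (((Re a - Im b) / 2)\<^sup>2 + ((Im a + Re b) / 2)\<^sup>2) * e\<^sup>2)"
    unfolding tw by (simp add: power2_eq_square field_simps)
  also have "((Re a - Im b) / 2)\<^sup>2 + ((Im a + Re b) / 2)\<^sup>2 = (cmod (shear F \<xi>))\<^sup>2"
  proof -
    have "Re (shear F \<xi>) = - (Re a - Im b) / 2" "Im (shear F \<xi>) = (Im a + Re b) / 2"
      by (simp_all add: sh)
    note re_im = this
    show ?thesis
      unfolding cmod_power2 re_im by (simp add: power_divide power2_commute)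
  qed
  finally show ?thesis
    by (simp add: e_def power_mult_distrib algebra_simps)
qed

end

theory Submission
  imports Defs
begin

text \<open>
  Write \<open>\<lambda>\<close> for the twist, \<open>\<sigma>\<close> for the shear, \<open>\<Delta> = \<lambda>\<^sup>2 - |\<sigma>|\<^sup>2\<close> and
  \<open>w = sgn \<Delta> / |\<Delta>|\<^bsup>1/2\<^esup>\<close>. On a nondegenerate graph \<open>\<Delta>\<close> has no zeros, so the area density
  can be differentiated. Since \<open>\<lambda>\<close> and \<open>\<sigma>\<close> are real linear in \<open>F\<close>, integration by parts
  turns the first variation into \<open>- 2 \<integral> Re (\<phi> X)\<close> with
  \<open>X = \<partial>\<^sup>- (e\<^bsup>2u\<^esup> w \<sigma>) - \<i> e\<^bsup>2u\<^esup> \<partial> (w \<lambda>)\<close>, where \<open>\<partial>\<^sup>-\<close> is the conjugate Wirtinger derivative.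
  With the smooth bump functions as variations, the graph is area-stationary if and only if
  \<open>X = 0\<close> on \<open>U\<close> (\<open>area_stationary_iff_euler_lagrange\<close>). Arbitrary variations are
  allowed here, not only rotationally symmetric ones.

  For \<open>F = (p(R) + \<i> q(R)) e\<^bsup>\<i>\<theta>\<^esup>\<close> all the quantities involved are multiplied by a power of
  \<open>e\<^bsup>\<i>C\<^esup>\<close> under the rotation by \<open>C\<close>, so \<open>X\<close> has to be tested on the positive real axis only;
  the origin, if it belongs to \<open>U\<close>, follows by continuity. There
  \<open>\<Delta> = (1 - R\<^sup>4) S' / (2 R) - R\<^sup>2 P'\<^sup>2 / 4\<close> with \<open>P = p / R\<close> and \<open>S = (q / (1 + R\<^sup>2))\<^sup>2\<close>,
  so that the area density depends on \<open>P'\<close> and \<open>S'\<close> but not on \<open>P\<close> and \<open>S\<close>. The two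
  components of \<open>X = 0\<close> express that the conjugate momenta
  \<open>N = R\<^sup>2 e\<^bsup>2u\<^esup> w (p' - p / R)\<close> and \<open>m = w (1 - R\<^sup>2) / (1 + R\<^sup>2)\<close> are conserved, except that
  the second one holds with an additional factor \<open>q\<close>, because \<open>S\<close> is quadratic in \<open>q\<close>
  (\<open>radial_euler_lagrange\<close>).

  The factor \<open>q\<close> is harmless: on an interval where \<open>q = 0\<close> the value of \<open>N\<close> would be
  \<open>\<plusminus> 2 R\<^sup>2 e\<^bsup>2u\<^esup>\<close>, which is not constant. Hence \<open>N = c\<^sub>1\<close> and \<open>m = c\<^sub>2\<close>, where
  \<open>c\<^sub>2 \<noteq> 0\<close>, and therefore \<open>R = 1\<close> does not occur. Now \<open>w\<close>, and with it \<open>\<Delta>\<close>, is explicit, and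
  the equations for \<open>P'\<close> and \<open>S'\<close> integrate to
  \<open>P = A\<^sub>1 + B\<^sub>1 (1 + R\<^sup>2)\<^sup>2 / R\<^sup>2\<close> and
  \<open>S = A\<^sub>2 R\<^sup>2 / (1 + R\<^sup>2)\<^sup>2 + B\<^sub>2 - B\<^sub>1\<^sup>2 (1 + R\<^sup>2)\<^sup>2 / R\<^sup>2\<close>
  with \<open>A\<^sub>2 = \<plusminus> c\<^sub>2\<^bsup>-2\<^esup>\<close> and \<open>B\<^sub>1 = - c\<^sub>1 / (8 c\<^sub>2)\<close>. The sign of the root is the same for all
  radii because \<open>q\<close> has no zeros (\<open>solution_if_momenta_constant\<close>). Conversely, the
  formula gives \<open>\<Delta> = A\<^sub>2 (1 - R\<^sup>2)\<^sup>2 / (1 + R\<^sup>2)\<^sup>2\<close>, hence \<open>m\<^sup>2 = 1 / |A\<^sub>2|\<close> and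
  \<open>N = - 8 B\<^sub>1 m\<close>, so both momenta are constant (\<open>momenta_constant_if_solution\<close>).
\<close>

section \<open>Calculus of functions of class \<open>C\<^sup>k\<close>\<close>

lemma has_derivative_cong_on_open:
  assumes "open U" "\<And>z. z \<in> U \<Longrightarrow> f z = g z" "z \<in> U"
  shows "(f has_derivative D) (at z) \<longleftrightarrow> (g has_derivative D) (at z)"
  using assms by (metis has_derivative_transform_within_open)

lemma frechet_derivative_cong_on_open:
  assumes "open U" "\<And>z. z \<in> U \<Longrightarrow> f z = g z" "z \<in> U"
  shows "frechet_derivative f (at z) = frechet_derivative g (at z)"
  unfolding frechet_derivative_def using has_derivative_cong_on_open[OF assms] by presburger

lemma Ck_on_cong:
  assumes "open U" "\<And>z. z \<in> U \<Longrightarrow> f z = g z"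
  shows "Ck_on n f U \<longleftrightarrow> Ck_on n g U"
  using assms(2)
proof (induction n arbitrary: f g)
  case 0
  then show ?case by (simp cong: continuous_on_cong)
next
  case (Suc n)
  have "f differentiable (at z) \<longleftrightarrow> g differentiable (at z)" if "z \<in> U" for z
    unfolding differentiable_def using has_derivative_cong_on_open[OF assms(1) Suc.prems that] by auto
  moreover have "Ck_on n (\<lambda>z. frechet_derivative f (at z) v) U
      \<longleftrightarrow> Ck_on n (\<lambda>z. frechet_derivative g (at z) v) U" for v
    by (rule Suc.IH) (simp add: frechet_derivative_cong_on_open[OF assms(1) Suc.prems])
  ultimately show ?case by simp
qed

text \<open>
  The class \<open>C\<^sup>k\<^sup>+\<^sup>1\<close> can be verified with any family of derivatives that is known explicitly;
  this is how all the closure properties below are obtained.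
\<close>

lemma Ck_on_SucI:
  assumes "open U" "\<And>z. z \<in> U \<Longrightarrow> (f has_derivative f' z) (at z)"
    and "\<And>v. Ck_on n (\<lambda>z. f' z v) U"
  shows "Ck_on (Suc n) f U"
proof -
  have "frechet_derivative f (at z) = f' z" if "z \<in> U" for z
    using frechet_derivative_at[OF assms(2)[OF that]] by simp
  then have "Ck_on n (\<lambda>z. frechet_derivative f (at z) v) U" for v
    using Ck_on_cong[OF assms(1), of "\<lambda>z. frechet_derivative f (at z) v" "\<lambda>z. f' z v"] assms(3)
    by simp
  then show ?thesis
    using assms(2) by (auto simp: differentiable_def)
qed

lemma Ck_on_SucD:
  assumes "Ck_on (Suc n) f U"
  shows "z \<in> U \<Longrightarrow> (f has_derivative frechet_derivative f (at z)) (at z)"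
    and "Ck_on n (\<lambda>z. frechet_derivative f (at z) v) U"
  using assms by (auto simp: frechet_derivative_works)

lemma Ck_on_imp_continuous_on: "Ck_on n f U \<Longrightarrow> continuous_on U f"
  by (cases n) (auto intro!: differentiable_imp_continuous_on
      simp: differentiable_on_def differentiable_at_withinI)

lemma Ck_on_Suc_imp: "Ck_on (Suc n) f U \<Longrightarrow> Ck_on n f U"
proof (induction n arbitrary: f)
  case 0
  then show ?case using Ck_on_imp_continuous_on[OF 0] by simp
next
  case (Suc n)
  have "Ck_on n (\<lambda>z. frechet_derivative f (at z) v) U" for v
    by (rule Suc.IH) (use Suc.prems in simp)
  then show ?case using Suc.prems by simp
qed

lemma Ck_on_subset: "Ck_on n f U \<Longrightarrow> V \<subseteq> U \<Longrightarrow> Ck_on n f V"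
  by (induction n arbitrary: f) (auto intro: continuous_on_subset)

lemma Ck_on_Un:
  assumes "open U" "open V" "Ck_on n f U" "Ck_on n f V"
  shows "Ck_on n f (U \<union> V)"
  using assms(3,4)
  by (induction n arbitrary: f) (auto intro: continuous_on_open_Un assms(1,2))

lemma Ck_on_const: "Ck_on n (\<lambda>z. c) U"
  by (induction n arbitrary: c) auto

lemma Ck_on_bounded_linear:
  assumes "bounded_linear f" "open U"
  shows "Ck_on n f U"
proof (cases n)
  case 0
  then show ?thesis using assms by (simp add: linear_continuous_on)
next
  case (Suc m)
  show ?thesis unfolding Suc
    by (rule Ck_on_SucI[OF assms(2) bounded_linear_imp_has_derivative[OF assms(1)] Ck_on_const])
qed

lemma Ck_on_linear_image:
  assumes "bounded_linear L" "open U" "Ck_on n f U"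
  shows "Ck_on n (\<lambda>z. L (f z)) U"
  using assms(3)
proof (induction n arbitrary: f)
  case 0
  then show ?case
    using assms(1) by (auto intro: bounded_linear.continuous_on)
next
  case (Suc n)
  show ?case
    by (rule Ck_on_SucI[OF assms(2) bounded_linear.has_derivative[OF assms(1) Ck_on_SucD(1)[OF Suc.prems]]])
       (use Suc.IH Ck_on_SucD(2)[OF Suc.prems] in auto)
qed

lemma Ck_on_add:
  assumes "open U" "Ck_on n f U" "Ck_on n g U"
  shows "Ck_on n (\<lambda>z. f z + g z) U"
  using assms(2,3)
proof (induction n arbitrary: f g)
  case 0
  then show ?case by (auto intro: continuous_intros)
next
  case (Suc n)
  show ?case
    by (rule Ck_on_SucI[OF assms(1) has_derivative_add[OF Suc.prems[THEN Ck_on_SucD(1)]]])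
       (use Suc.IH Suc.prems[THEN Ck_on_SucD(2)] in auto)
qed

lemma Ck_on_mult:
  assumes "open U" "Ck_on n f U" "Ck_on n g U"
  shows "Ck_on n (\<lambda>z. f z * g z) U"
  using assms(2,3)
proof (induction n arbitrary: f g)
  case 0
  then show ?case by (auto intro: continuous_intros)
next
  case (Suc n)
  show ?case
    by (rule Ck_on_SucI[OF assms(1) has_derivative_mult[OF Suc.prems[THEN Ck_on_SucD(1)]]])
       (use Suc.IH Suc.prems[THEN Ck_on_SucD(2)] Suc.prems[THEN Ck_on_Suc_imp] in
        \<open>auto intro!: Ck_on_add[OF assms(1)]\<close>)
qed

lemma Ck_on_cnj: "open U \<Longrightarrow> Ck_on n f U \<Longrightarrow> Ck_on n (\<lambda>z. cnj (f z)) U"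
  by (rule Ck_on_linear_image[OF bounded_linear_cnj])

lemma Ck_on_of_real_Im:
  assumes "open U" "Ck_on n f U"
  shows "Ck_on n (\<lambda>z. complex_of_real (Im (f z))) U"
  by (rule Ck_on_linear_image[OF _ assms])
     (rule bounded_linear_compose[OF bounded_linear_of_real bounded_linear_Im])

text \<open>
  Used for \<open>g(x) = sgn x / |x|\<^bsup>1/2\<^esup>\<close>, which is of class \<open>C\<^sup>1\<close> only away from the origin.
\<close>

lemma C1_on_compose_real:
  assumes "open U" "Ck_on 1 (\<lambda>z. complex_of_real (h z)) U"
    and "\<And>z. z \<in> U \<Longrightarrow> (g has_real_derivative g' (h z)) (at (h z))"
    and "continuous_on (h ` U) g'"
  shows "Ck_on 1 (\<lambda>z. complex_of_real (g (h z))) U"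
proof -
  let ?H = "\<lambda>z. complex_of_real (h z)"
  let ?D = "\<lambda>z v. Re (frechet_derivative ?H (at z) v)"
  note H = assms(2)[unfolded One_nat_def]
  have dh: "(h has_derivative ?D z) (at z)" if "z \<in> U" for z
    using bounded_linear.has_derivative[OF bounded_linear_Re Ck_on_SucD(1)[OF H that]] by simp
  have ch: "continuous_on U h"
    using continuous_on_Re[OF Ck_on_imp_continuous_on[OF H]] by simp
  show ?thesis unfolding One_nat_def
  proof (rule Ck_on_SucI[OF assms(1)])
    fix z assume z: "z \<in> U"
    have "((\<lambda>z. g (h z)) has_derivative (\<lambda>v. ?D z v * g' (h z))) (at z)"
      by (rule DERIV_compose_FDERIV[OF assms(3)[OF z] dh[OF z]])
    then show "((\<lambda>z. complex_of_real (g (h z))) has_derivative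
        (\<lambda>v. complex_of_real (?D z v * g' (h z)))) (at z)"
      by (rule has_derivative_of_real)
  next
    fix v
    have "continuous_on U (\<lambda>z. frechet_derivative ?H (at z) v)"
      using Ck_on_SucD(2)[OF H, of v] by simp
    moreover have "continuous_on U (\<lambda>z. g' (h z))"
      by (rule continuous_on_compose2[OF assms(4) ch]) auto
    ultimately show "Ck_on 0 (\<lambda>z. complex_of_real (?D z v * g' (h z))) U"
      by (auto intro!: continuous_intros)
  qed
qed

section \<open>A smooth bump function\<close>

text \<open>
  The powers of \<open>t\<close> in the denominator make the family closed under differentiation, so that
  smoothness of all its members follows from one induction.
\<close>

definition flat :: "nat \<Rightarrow> real \<Rightarrow> real" where
  "flat k t = (if t > 0 then exp (- 1 / t) / t ^ k else 0)"

lemma flat_nonneg: "flat k t \<ge> 0"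
  by (simp add: flat_def)

lemma flat_tendsto_0: "(flat k \<longlongrightarrow> 0) (at 0)"
proof -
  have "((\<lambda>t::real. inverse t ^ k / exp (inverse t)) \<longlongrightarrow> 0) (at_right 0)"
    by (rule filterlim_compose[OF tendsto_power_div_exp_0 filterlim_inverse_at_top_right])
  moreover have "\<forall>\<^sub>F t in at_right 0. inverse t ^ k / exp (inverse t) = flat k t"
    by (auto simp: eventually_at_right_field flat_def field_simps exp_minus intro!: exI[of _ 1])
  ultimately have "(flat k \<longlongrightarrow> 0) (at_right 0)"
    by (simp cong: tendsto_cong)
  moreover have "\<forall>\<^sub>F t in at_left 0. 0 = flat k t"
    by (auto simp: eventually_at_left_field flat_def intro!: exI[of _ "-1"])
  then have "(flat k \<longlongrightarrow> 0) (at_left 0)"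
    using tendsto_cong[of "\<lambda>_. 0" "flat k"] by force
  ultimately show ?thesis
    by (simp add: filterlim_at_split)
qed

lemma flat_has_derivative:
  "(flat k has_real_derivative flat (k + 2) t - real k * flat (k + 1) t) (at t)"
proof -
  consider "t > 0" | "t = 0" | "t < 0" by linarith
  then show ?thesis
  proof cases
    case 1
    have "((\<lambda>t. exp (- 1 / t) / t ^ k) has_real_derivative
        flat (k + 2) t - real k * flat (k + 1) t) (at t)"
      using 1
      by (auto intro!: derivative_eq_intros simp: flat_def field_simps power2_eq_square)
        (cases k; simp add: algebra_simps)
    then show ?thesis
      by (rule has_field_derivative_transform_within_open[where S = "{0<..}"])
         (use 1 in \<open>auto simp: flat_def\<close>)
  next
    case 2
    have "flat (k + 1) h = (flat k (0 + h) - flat k 0) / h" for h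
      by (simp add: flat_def)
    then have "flat (k + 1) = (\<lambda>h. (flat k (0 + h) - flat k 0) / h)"
      by (rule ext)
    then have "((\<lambda>h. (flat k (0 + h) - flat k 0) / h) \<longlongrightarrow> 0) (at 0)"
      using flat_tendsto_0[of "k + 1"] by (simp only:)
    then show ?thesis
      using 2 by (simp add: DERIV_def flat_def)
  next
    case 3
    have "((\<lambda>t. 0) has_real_derivative flat (k + 2) t - real k * flat (k + 1) t) (at t)"
      using 3 by (simp add: flat_def)
    then show ?thesis
      by (rule has_field_derivative_transform_within_open[where S = "{..<0}"])
         (use 3 in \<open>auto simp: flat_def\<close>)
  qed
qed

definition bump :: "complex \<Rightarrow> real \<Rightarrow> complex \<Rightarrow> real" where
  "bump c r z = flat 0 (r\<^sup>2 - (cmod (z - c))\<^sup>2)"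

text \<open>
  The induction is over the order of differentiability, for all \<open>k\<close> at once: the derivative
  of \<open>flat k\<close> is a combination of \<open>flat (k + 1)\<close> and \<open>flat (k + 2)\<close>.
\<close>

lemma Ck_on_flat: "Ck_on n (\<lambda>z. complex_of_real (flat k (r\<^sup>2 - (cmod (z - c))\<^sup>2))) UNIV"
proof (induction n arbitrary: k)
  case 0
  have "continuous_on UNIV (flat k)"
    using flat_has_derivative by (meson DERIV_isCont continuous_at_imp_continuous_on)
  then have "continuous_on UNIV (\<lambda>z. flat k (r\<^sup>2 - (cmod (z - c))\<^sup>2))"
    by (rule continuous_on_compose2) (auto intro!: continuous_intros)
  then show ?case
    by (simp add: continuous_on_of_real)
next
  case (Suc n)
  let ?h = "\<lambda>z. r\<^sup>2 - (cmod (z - c))\<^sup>2"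
  let ?d = "\<lambda>z v. - (2 * ((z - c) \<bullet> v))"
  have D: "((\<lambda>z. complex_of_real (flat k (?h z))) has_derivative
      (\<lambda>v. complex_of_real (?d z v * (flat (k + 2) (?h z) - real k * flat (k + 1) (?h z))))) (at z)" for z
  proof (rule has_derivative_of_real)
    have h: "(?h has_derivative ?d z) (at z)"
      unfolding power2_norm_eq_inner
      by (auto intro!: derivative_eq_intros simp: inner_commute)
    show "((\<lambda>z. flat k (?h z)) has_derivative
      (\<lambda>v. ?d z v * (flat (k + 2) (?h z) - real k * flat (k + 1) (?h z)))) (at z)"
      by (rule DERIV_compose_FDERIV[OF flat_has_derivative h])
  qed
  have lin: "Ck_on n (\<lambda>z. complex_of_real (?d z v)) UNIV" for v
  proof -
    have "Ck_on n (\<lambda>z. complex_of_real (- (2 * (z \<bullet> v)))) UNIV"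
      by (rule Ck_on_bounded_linear[OF bounded_linear_compose[OF bounded_linear_of_real
            bounded_linear_minus[OF bounded_linear_const_mult[OF bounded_linear_inner_left]]] open_UNIV])
    from Ck_on_add[OF open_UNIV this Ck_on_const[of n "complex_of_real (2 * (c \<bullet> v))"]]
    show ?thesis by (simp add: inner_diff_left algebra_simps)
  qed
  have "Ck_on n (\<lambda>z. complex_of_real (?d z v * (flat (k + 2) (?h z) - real k * flat (k + 1) (?h z)))) UNIV" for v
  proof -
    have "Ck_on n (\<lambda>z. complex_of_real (flat (k + 2) (?h z)) + complex_of_real (- real k) * complex_of_real (flat (k + 1) (?h z))) UNIV"
      by (intro Ck_on_add Ck_on_mult Ck_on_const Suc.IH open_UNIV)
    from Ck_on_mult[OF open_UNIV lin this] show ?thesis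
      by simp
  qed
  then show ?case
    by (rule Ck_on_SucI[OF open_UNIV D])
qed

lemma smooth_on_bump: "smooth_on (\<lambda>z. b * complex_of_real (bump c r z)) UNIV"
  unfolding smooth_on_def bump_def by (intro allI Ck_on_mult Ck_on_const Ck_on_flat open_UNIV)

section \<open>Calculus of variations in the plane\<close>

lemma has_vector_derivative_along_line:
  assumes "(f has_derivative D) (at (z + t *\<^sub>R v))"
  shows "((\<lambda>t. f (z + t *\<^sub>R v)) has_vector_derivative D v) (at t)"
proof -
  have "((\<lambda>t. z + t *\<^sub>R v) has_derivative (\<lambda>h. h *\<^sub>R v)) (at t)"
    by (auto intro!: derivative_eq_intros)
  from has_derivative_compose[OF this assms]
  have "((\<lambda>t. f (z + t *\<^sub>R v)) has_derivative (\<lambda>h. D (h *\<^sub>R v))) (at t)" .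
  moreover have "D (h *\<^sub>R v) = h *\<^sub>R D v" for h
    using has_derivative_linear[OF assms] by (rule linear_scale)
  ultimately show ?thesis
    by (simp add: has_vector_derivative_def)
qed

lemma frechet_derivative_eq_0_outside_support:
  fixes f :: "complex \<Rightarrow> complex"
  assumes "closed K" "\<And>z. z \<notin> K \<Longrightarrow> f z = 0" "z \<notin> K"
  shows "frechet_derivative f (at z) v = 0"
proof -
  have "open (- K)" using assms(1) by (simp add: open_Compl)
  then have "frechet_derivative f (at z) = frechet_derivative (\<lambda>_. 0) (at z)"
    by (rule frechet_derivative_cong_on_open) (use assms in auto)
  then show ?thesis by simp
qed

lemma lebesgue_integral_translate:
  fixes f :: "complex \<Rightarrow> complex"
  assumes "f \<in> borel_measurable borel"
  shows "(LINT z|lborel. f (z + a)) = (LINT z|lborel. f z)"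
proof -
  have "(LINT z|lborel. f (a + z)) = (LINT z|distr lborel borel ((+) a). f z)"
    by (rule integral_distr[symmetric]) (use assms in auto)
  then show ?thesis
    by (simp add: lborel_distr_plus add.commute)
qed

text \<open>
  The divergence theorem for compactly supported functions, without iterated integrals:
  by translation invariance of the Lebesgue measure every difference quotient of \<open>f\<close> in the
  direction \<open>v\<close> has integral 0, and these quotients converge dominatedly to the derivative.
\<close>

lemma integral_frechet_derivative_eq_0:
  fixes f :: "complex \<Rightarrow> complex"
  assumes f: "Ck_on 1 f UNIV" and K: "compact K" and supp: "\<And>z. z \<notin> K \<Longrightarrow> f z = 0"
  shows "(LINT z|lborel. frechet_derivative f (at z) v) = 0"
proof -
  define D where "D z = frechet_derivative f (at z) v" for z
  note f' = f[unfolded One_nat_def]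
  have contf: "continuous_on UNIV f"
    by (rule Ck_on_imp_continuous_on[OF f])
  have contD: "continuous_on UNIV D"
    using Ck_on_SucD(2)[OF f', of v] by (simp add: D_def[abs_def])
  have D0: "D z = 0" if "z \<notin> K" for z
    unfolding D_def by (rule frechet_derivative_eq_0_outside_support[OF compact_imp_closed[OF K] supp that])
  obtain B where B: "B > 0" "\<And>z. norm (D z) \<le> B"
  proof -
    have "bounded (D ` K)"
      by (intro compact_imp_bounded compact_continuous_image K continuous_on_subset[OF contD]) auto
    then obtain B where "B > 0" "\<forall>x\<in>D ` K. norm x \<le> B"
      using bounded_pos by blast
    then show ?thesis
      using D0 that[of B] by (metis imageI less_imp_le norm_zero)
  qed
  have line: "((\<lambda>t. f (z + t *\<^sub>R v)) has_vector_derivative D (z + t *\<^sub>R v)) (at t)" for z t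
    unfolding D_def by (rule has_vector_derivative_along_line[OF Ck_on_SucD(1)[OF f']]) auto
  have lip: "norm (f (z + t *\<^sub>R v) - f z) \<le> B * \<bar>t\<bar>" for z t
  proof -
    have "norm (f (z + t *\<^sub>R v) - f (z + 0 *\<^sub>R v)) \<le> B * norm (t - 0)"
    proof (rule differentiable_bound[where S = UNIV])
      show "((\<lambda>t. f (z + t *\<^sub>R v)) has_derivative (\<lambda>h. h *\<^sub>R D (z + t *\<^sub>R v))) (at t within UNIV)" for t
        using line[of z t] by (simp add: has_vector_derivative_def)
      show "onorm (\<lambda>h. h *\<^sub>R D (z + t *\<^sub>R v)) \<le> B" for t
        by (rule onorm_bound) (use B in \<open>auto simp: mult.commute[of B] mult_left_mono\<close>)
    qed auto
    then show ?thesis by simp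
  qed
  obtain r where "\<forall>x\<in>K. norm x \<le> r"
    using compact_imp_bounded[OF K] unfolding bounded_iff by (elim exE)
  then have r: "K \<subseteq> cball 0 r"
    by auto
  define K1 where "K1 = cball (0::complex) (r + norm v)"
  define h where "h n = inverse (real (Suc n))" for n
  have h: "h n > 0" "h n \<le> 1" for n
    by (simp_all add: h_def inverse_le_1_iff)
  \<comment> \<open>The difference quotients; \<open>K1\<close> contains the supports of all of them because \<open>h n \<le> 1\<close>.\<close>
  define s where "s n z = (f (z + h n *\<^sub>R v) - f z) /\<^sub>R h n" for n z
  have meas: "(\<lambda>z. f (z + a)) \<in> borel_measurable borel" for a
    by (intro borel_measurable_continuous_onI continuous_on_compose2[OF contf] continuous_intros) auto
  have int: "integrable lborel (\<lambda>z. f (z + a))" for a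
  proof -
    have "compact ((\<lambda>z. z - a) ` K)"
      by (intro compact_continuous_image K continuous_intros)
    then have "integrable lborel (\<lambda>z. indicator ((\<lambda>z. z - a) ` K) z *\<^sub>R f (z + a))"
      by (rule borel_integrable_compact)
        (auto intro!: continuous_on_compose2[OF contf] continuous_intros)
    moreover have "indicator ((\<lambda>z. z - a) ` K) z *\<^sub>R f (z + a) = f (z + a)" for z
      using supp[of "z + a"] by (force simp: indicator_def image_iff)
    ultimately show ?thesis by simp
  qed
  have "(\<lambda>n. integral\<^sup>L lborel (s n)) \<longlonglongrightarrow> integral\<^sup>L lborel D"
  proof (rule integral_dominated_convergence[where w = "\<lambda>z. indicator K1 z *\<^sub>R B"])
    show "D \<in> borel_measurable lborel"
      using borel_measurable_continuous_onI[OF contD] by simp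
    show "s n \<in> borel_measurable lborel" for n
      unfolding s_def using meas[of "h n *\<^sub>R v"] meas[of 0] by simp
    show "integrable lborel (\<lambda>z. indicator K1 z *\<^sub>R B)"
      unfolding K1_def by (rule borel_integrable_compact) auto
    show "AE z in lborel. (\<lambda>n. s n z) \<longlonglongrightarrow> D z"
    proof (rule AE_I2)
      fix z
      have "((\<lambda>t. (f (z + t *\<^sub>R v) - f z) /\<^sub>R t) \<longlongrightarrow> D z) (at 0)"
      proof -
        have "((\<lambda>t. norm (f (z + t *\<^sub>R v) - f z - t *\<^sub>R D z) / norm t) \<longlongrightarrow> 0) (at 0)"
          using line[of z 0] by (simp add: has_vector_derivative_def has_derivative_at)
        moreover have "norm (f (z + t *\<^sub>R v) - f z - t *\<^sub>R D z) / norm t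
            = norm ((f (z + t *\<^sub>R v) - f z) /\<^sub>R t - D z)" if "t \<noteq> 0" for t
        proof -
          have "(f (z + t *\<^sub>R v) - f z) /\<^sub>R t - D z = (f (z + t *\<^sub>R v) - f z - t *\<^sub>R D z) /\<^sub>R t"
            using that by (simp add: algebra_simps)
          then show ?thesis by (simp add: divide_inverse_commute)
        qed
        then have "\<forall>\<^sub>F t in at 0. norm (f (z + t *\<^sub>R v) - f z - t *\<^sub>R D z) / norm t
            = norm ((f (z + t *\<^sub>R v) - f z) /\<^sub>R t - D z)"
          by (simp add: eventually_at_filter)
        ultimately have "((\<lambda>t. norm ((f (z + t *\<^sub>R v) - f z) /\<^sub>R t - D z)) \<longlongrightarrow> 0) (at 0)"
          by (rule Lim_transform_eventually)
        then show ?thesis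
          by (simp add: tendsto_norm_zero_iff LIM_zero_iff)
      qed
      moreover have "filterlim h (at 0) sequentially"
        unfolding filterlim_at h_def using LIMSEQ_inverse_real_of_nat by auto
      ultimately show "(\<lambda>n. s n z) \<longlonglongrightarrow> D z"
        unfolding s_def by (rule filterlim_compose)
    qed
    show "AE z in lborel. norm (s n z) \<le> indicator K1 z *\<^sub>R B" for n
    proof (rule AE_I2)
      fix z
      show "norm (s n z) \<le> indicator K1 z *\<^sub>R B"
      proof (cases "z \<in> K1")
        case True
        have "norm (s n z) \<le> inverse (h n) * (B * h n)"
          using lip[of z "h n"] h[of n] by (simp add: s_def mult_left_mono)
        also have "\<dots> = B"
          using h(1)[of n] by simp
        finally show ?thesis using True by simp
      next
        case False
        then have z: "norm z > r + norm v" by (simp add: K1_def)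
        have "norm (h n *\<^sub>R v) \<le> norm v"
          using h[of n] by (simp add: mult_left_le_one_le)
        then have "norm (z + h n *\<^sub>R v) > r"
          using z norm_triangle_ineq4[of "z + h n *\<^sub>R v" "h n *\<^sub>R v"] by simp
        moreover have "norm z > r"
          using z by (smt (verit) norm_ge_zero)
        ultimately have "z + h n *\<^sub>R v \<notin> K" "z \<notin> K"
          using r by (auto simp: subset_iff)
        then show ?thesis using supp False by (simp add: s_def)
      qed
    qed
  qed
  moreover have "integral\<^sup>L lborel (s n) = 0" for n
  proof -
    have "f \<in> borel_measurable borel" "integrable lborel f"
      using meas[of 0] int[of 0] by simp_all
    then show ?thesis
      unfolding s_def using int[of "h n *\<^sub>R v"]
      by (simp add: lebesgue_integral_translate)
  qed
  ultimately show ?thesis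
    unfolding D_def[symmetric] by (simp add: LIMSEQ_const_iff)
qed

text \<open>
  First-order Taylor expansion of \<open>|a|\<^bsup>1/2\<^esup>\<close> with a remainder that is uniform in all \<open>a\<close> with
  \<open>|a| \<ge> \<delta>\<close>; the condition on \<open>x\<close> keeps \<open>a + x\<close> on the same side of 0.
\<close>

lemma sqrt_abs_taylor:
  fixes a x :: real
  assumes "0 < \<delta>" "\<delta> \<le> \<bar>a\<bar>" "\<bar>x\<bar> < \<delta>"
  shows "\<bar>sqrt \<bar>a + x\<bar> - sqrt \<bar>a\<bar> - sgn a * x / (2 * sqrt \<bar>a\<bar>)\<bar> \<le> x\<^sup>2 / (2 * \<delta> * sqrt \<delta>)"
proof -
  have pos: "\<bar>sqrt (b + y) - sqrt b - y / (2 * sqrt b)\<bar> \<le> y\<^sup>2 / (2 * \<delta> * sqrt \<delta>)"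
    if b: "\<delta> \<le> b" "\<bar>y\<bar> < \<delta>" for b y
  proof -
    define u where "u = sqrt b"
    define w where "w = sqrt (b + y)"
    have u: "u > 0" "u\<^sup>2 = b" and w: "w \<ge> 0" "w\<^sup>2 = b + y"
      using assms(1) b by (auto simp: u_def w_def)
    have y: "y = (w - u) * (w + u)"
      using u(2) w(2) by (simp add: power2_eq_square algebra_simps)
    have "w - u - y / (2 * u) = - ((w - u)\<^sup>2 / (2 * u))"
      using u(1) unfolding y by (simp add: field_simps power2_eq_square)
    then have 1: "\<bar>w - u - y / (2 * u)\<bar> = (w - u)\<^sup>2 / (2 * u)"
      using u(1) by simp
    have "(w - u)\<^sup>2 * \<delta> \<le> (w - u)\<^sup>2 * (w + u)\<^sup>2"
    proof (rule mult_left_mono)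
      have "\<delta> \<le> u\<^sup>2" using b u by simp
      also have "\<dots> \<le> (w + u)\<^sup>2" using u(1) w(1) by (intro power_mono) auto
      finally show "\<delta> \<le> (w + u)\<^sup>2" .
    qed simp
    also have "\<dots> = y\<^sup>2" unfolding y by (simp add: power_mult_distrib)
    finally have 2: "(w - u)\<^sup>2 \<le> y\<^sup>2 / \<delta>"
      using assms(1) by (simp add: field_simps)
    have "sqrt \<delta> \<le> u" unfolding u_def using b by simp
    then have "(w - u)\<^sup>2 / (2 * u) \<le> (y\<^sup>2 / \<delta>) / (2 * sqrt \<delta>)"
      using 2 assms(1) by (intro frac_le) auto
    then show ?thesis
      using 1 by (simp add: u_def w_def mult_ac)
  qed
  show ?thesis
  proof (cases "a > 0")
    case True
    moreover have "\<bar>a + x\<bar> = a + x" using True assms by linarith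
    ultimately show ?thesis using pos[of a x] assms by simp
  next
    case False
    with assms have "a < 0" by linarith
    moreover have "\<bar>a + x\<bar> = - a + - x" using \<open>a < 0\<close> assms by linarith
    ultimately show ?thesis using pos[of "- a" "- x"] assms by simp
  qed
qed

lemma has_real_derivative_if_quadratic_remainder:
  fixes f :: "real \<Rightarrow> real"
  assumes "\<eta> > 0" "\<And>t. \<bar>t\<bar> < \<eta> \<Longrightarrow> \<bar>f t - f 0 - t * E\<bar> \<le> L * t\<^sup>2"
  shows "(f has_real_derivative E) (at 0)"
proof -
  have "((\<lambda>t. (f t - f 0) / t - E) \<longlongrightarrow> 0) (at 0)"
  proof (rule Lim_null_comparison)
    show "\<forall>\<^sub>F t in at 0. norm ((f t - f 0) / t - E) \<le> L * \<bar>t\<bar>"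
      unfolding eventually_at
    proof (intro exI[of _ \<eta>] conjI ballI impI)
      fix t :: real assume t: "t \<noteq> 0 \<and> dist t 0 < \<eta>"
      then have "norm ((f t - f 0) / t - E) = \<bar>f t - f 0 - t * E\<bar> / \<bar>t\<bar>"
        by (simp add: field_simps flip: abs_divide)
      also have "\<dots> \<le> (L * t\<^sup>2) / \<bar>t\<bar>"
        using assms(2)[of t] t by (intro divide_right_mono) auto
      also have "\<dots> = L * \<bar>t\<bar>"
        using t by (simp add: power2_eq_square abs_if)
      finally show "norm ((f t - f 0) / t - E) \<le> L * \<bar>t\<bar>" .
    qed (use assms in auto)
    show "((\<lambda>t. L * \<bar>t\<bar>) \<longlongrightarrow> 0) (at 0)"
      by (auto intro!: tendsto_eq_intros)
  qed
  then have "((\<lambda>t. (f t - f 0) / t) \<longlongrightarrow> E) (at 0)"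
    by (simp add: LIM_zero_iff)
  then show ?thesis
    by (simp add: DERIV_def)
qed

text \<open>
  On the compact set \<open>K\<close> the function \<open>|a|\<close> is bounded away from 0, so the Taylor remainder
  of the integrand is at most \<open>L t\<^sup>2\<close> uniformly on \<open>K\<close>, and it can be integrated.
\<close>

lemma first_variation_of_sqrt_integral:
  fixes a b c g :: "complex \<Rightarrow> real"
  assumes K: "compact K" and cont: "continuous_on K a" "continuous_on K b" "continuous_on K c" "continuous_on K g"
    and nz: "\<And>z. z \<in> K \<Longrightarrow> a z \<noteq> 0"
  shows "((\<lambda>t. LINT z:K|lborel. sqrt \<bar>a z + 2 * t * b z + t\<^sup>2 * c z\<bar> * g z) has_real_derivative
           (LINT z:K|lborel. sgn (a z) / sqrt \<bar>a z\<bar> * b z * g z)) (at 0)"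
proof (cases "K = {}")
  case True
  then show ?thesis by (simp add: set_lebesgue_integral_def)
next
  case False
  obtain \<delta> where \<delta>: "\<delta> > 0" "\<And>z. z \<in> K \<Longrightarrow> \<delta> \<le> \<bar>a z\<bar>"
  proof -
    obtain z0 where "z0 \<in> K" "\<And>z. z \<in> K \<Longrightarrow> \<bar>a z0\<bar> \<le> \<bar>a z\<bar>"
      using continuous_attains_inf[OF K False continuous_on_rabs[OF cont(1)]] by blast
    then show ?thesis using that[of "\<bar>a z0\<bar>"] nz by auto
  qed
  obtain M where M: "M > 0" "\<And>z. z \<in> K \<Longrightarrow> 2 * \<bar>b z\<bar> + \<bar>c z\<bar> \<le> M"
  proof -
    have "bounded ((\<lambda>z. 2 * \<bar>b z\<bar> + \<bar>c z\<bar>) ` K)"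
      by (intro compact_imp_bounded compact_continuous_image K continuous_intros cont)
    then show ?thesis
      using that unfolding bounded_pos by auto
  qed
  define L where "L = M\<^sup>2 / (2 * \<delta> * sqrt \<delta>) + M / (2 * sqrt \<delta>)"
  define \<eta> where "\<eta> = min 1 (\<delta> / M)"
  let ?r = "\<lambda>t z. sqrt \<bar>a z + 2 * t * b z + t\<^sup>2 * c z\<bar>"
  let ?l = "\<lambda>z. sgn (a z) / sqrt \<bar>a z\<bar> * b z"
  have bound: "\<bar>?r t z - ?r 0 z - t * ?l z\<bar> \<le> L * t\<^sup>2" if t: "\<bar>t\<bar> < \<eta>" and z: "z \<in> K" for t z
  proof -
    define x where "x = 2 * t * b z + t\<^sup>2 * c z"
    have t1: "\<bar>t\<bar> \<le> 1" "\<bar>t\<bar> * M < \<delta>"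
      using t M(1) by (auto simp: \<eta>_def field_simps)
    have "\<bar>x\<bar> \<le> \<bar>t\<bar> * (2 * \<bar>b z\<bar>) + \<bar>t\<bar> * (\<bar>t\<bar> * \<bar>c z\<bar>)"
      unfolding x_def power2_eq_square
      by (rule order_trans[OF abs_triangle_ineq]) (simp add: abs_mult)
    also have "\<dots> \<le> \<bar>t\<bar> * (2 * \<bar>b z\<bar>) + \<bar>t\<bar> * \<bar>c z\<bar>"
      using t1 by (intro add_left_mono mult_left_mono mult_left_le_one_le) auto
    also have "\<dots> \<le> \<bar>t\<bar> * M"
      using M(2)[OF z] by (simp add: mult_left_mono flip: distrib_left)
    finally have x: "\<bar>x\<bar> \<le> \<bar>t\<bar> * M" .
    have x2: "x\<^sup>2 \<le> t\<^sup>2 * M\<^sup>2"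
      using power_mono[OF x, of 2] by (simp add: power_mult_distrib)
    have A: "\<bar>sqrt \<bar>a z + x\<bar> - sqrt \<bar>a z\<bar> - sgn (a z) * x / (2 * sqrt \<bar>a z\<bar>)\<bar> \<le> t\<^sup>2 * M\<^sup>2 / (2 * \<delta> * sqrt \<delta>)"
      by (rule order_trans[OF sqrt_abs_taylor[OF \<delta>(1) \<delta>(2)[OF z]]])
         (use x t1 x2 \<delta>(1) in \<open>auto intro!: divide_right_mono\<close>)
    have "\<bar>sgn (a z) * (t\<^sup>2 * c z) / (2 * sqrt \<bar>a z\<bar>)\<bar> = t\<^sup>2 * \<bar>c z\<bar> / (2 * sqrt \<bar>a z\<bar>)"
      using nz[OF z] by (simp add: abs_mult abs_sgn_eq)
    also have "\<dots> \<le> t\<^sup>2 * M / (2 * sqrt \<delta>)"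
      using M(2)[OF z] \<delta> z by (intro frac_le mult_left_mono) auto
    finally have B: "\<bar>sgn (a z) * (t\<^sup>2 * c z) / (2 * sqrt \<bar>a z\<bar>)\<bar> \<le> t\<^sup>2 * M / (2 * sqrt \<delta>)" .
    have "?r t z - ?r 0 z - t * ?l z = (sqrt \<bar>a z + x\<bar> - sqrt \<bar>a z\<bar> - sgn (a z) * x / (2 * sqrt \<bar>a z\<bar>))
        + sgn (a z) * (t\<^sup>2 * c z) / (2 * sqrt \<bar>a z\<bar>)"
      using nz[OF z] by (simp add: x_def field_simps)
    then have "\<bar>?r t z - ?r 0 z - t * ?l z\<bar> \<le> t\<^sup>2 * M\<^sup>2 / (2 * \<delta> * sqrt \<delta>) + t\<^sup>2 * M / (2 * sqrt \<delta>)"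
      using order_trans[OF abs_triangle_ineq add_mono[OF A B]] by (simp only:)
    also have "\<dots> = L * t\<^sup>2"
      by (simp add: L_def algebra_simps)
    finally show ?thesis .
  qed
  have int: "set_integrable lborel K f" if "continuous_on K f" for f :: "complex \<Rightarrow> real"
    unfolding set_integrable_def by (rule borel_integrable_compact[OF K that])
  have cr: "continuous_on K (\<lambda>z. ?r t z * g z)" for t
    by (intro continuous_intros cont)
  have cl: "continuous_on K (\<lambda>z. ?l z * g z)"
  proof -
    have "continuous_on K (\<lambda>z. a z / \<bar>a z\<bar> / sqrt \<bar>a z\<bar> * b z * g z)"
      by (intro continuous_intros cont) (use nz in auto)
    then show ?thesis
      by (rule continuous_on_eq) (use nz in \<open>auto simp: sgn_if\<close>)
  qed
  show ?thesis
  proof (rule has_real_derivative_if_quadratic_remainder[where \<eta> = \<eta> and L = "L * (LINT z:K|lborel. \<bar>g z\<bar>)"])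
    show "\<eta> > 0" using \<delta> M by (simp add: \<eta>_def)
    fix t :: real assume t: "\<bar>t\<bar> < \<eta>"
    define d where "d z = ?r t z * g z - ?r 0 z * g z - t * (?l z * g z)" for z
    have cd: "continuous_on K d"
      unfolding d_def by (intro continuous_on_diff continuous_on_mult[OF continuous_on_const] cr cl)
    note tl = int[OF continuous_on_mult[OF continuous_on_const cl], of t]
    have split: "(LINT z:K|lborel. d z) = (LINT z:K|lborel. ?r t z * g z) - (LINT z:K|lborel. ?r 0 z * g z)
        - t * (LINT z:K|lborel. ?l z * g z)"
      unfolding d_def set_integral_diff(2)[OF set_integral_diff(1)[OF int[OF cr] int[OF cr]] tl]
          set_integral_diff(2)[OF int[OF cr] int[OF cr]] by (simp only: set_integral_mult_right)
    have abs_d: "\<bar>d z\<bar> \<le> (L * t\<^sup>2) * \<bar>g z\<bar>" if z: "z \<in> K" for z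
    proof -
      have "d z = (?r t z - ?r 0 z - t * ?l z) * g z"
        unfolding d_def by (simp only: left_diff_distrib mult.assoc)
      then have "\<bar>d z\<bar> = \<bar>?r t z - ?r 0 z - t * ?l z\<bar> * \<bar>g z\<bar>"
        by (simp only: abs_mult)
      then show ?thesis
        using mult_right_mono[OF bound[OF t z] abs_ge_zero[of "g z"]] by (simp only:)
    qed
    have "\<bar>LINT z:K|lborel. d z\<bar> \<le> (LINT z:K|lborel. \<bar>d z\<bar>)"
      using set_integral_norm_bound[OF int[OF cd]] by (simp only: real_norm_def)
    also have "\<dots> \<le> (LINT z:K|lborel. (L * t\<^sup>2) * \<bar>g z\<bar>)"
      by (rule set_integral_mono[OF int[OF continuous_on_rabs[OF cd]]
            int[OF continuous_on_mult[OF continuous_on_const continuous_on_rabs[OF cont(4)]]] abs_d])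
    also have "\<dots> = L * (LINT z:K|lborel. \<bar>g z\<bar>) * t\<^sup>2"
      unfolding set_integral_mult_right by (simp only: mult_ac)
    finally show "\<bar>(LINT z:K|lborel. ?r t z * g z) - (LINT z:K|lborel. ?r 0 z * g z)
        - t * (LINT z:K|lborel. ?l z * g z)\<bar> \<le> L * (LINT z:K|lborel. \<bar>g z\<bar>) * t\<^sup>2"
      unfolding split .
  qed
qed

text \<open>
  The variation is a bump multiplied by the constant \<open>cnj (X z0)\<close>, and it is supported where
  \<open>Re (cnj (X z0) * X z) > 0\<close>, so that the integrand is nonnegative.
\<close>

lemma fundamental_lemma_of_variations:
  fixes X :: "complex \<Rightarrow> complex"
  assumes U: "open U" and X: "continuous_on U X" and z0: "z0 \<in> U" and nz: "X z0 \<noteq> 0"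
  obtains \<phi> K where "smooth_on \<phi> UNIV" "compact K" "K \<subseteq> U" "\<And>z. z \<notin> K \<Longrightarrow> \<phi> z = 0"
    "(LINT z:K|lborel. Re (\<phi> z * X z)) > 0"
proof -
  define h where "h z = Re (cnj (X z0) * X z)" for z
  have h: "continuous_on U h" unfolding h_def by (intro continuous_intros X)
  have h0: "h z0 > 0" unfolding h_def using nz by (simp add: complex_neq_0 flip: power2_eq_square)
  have "open {z \<in> U. h z > 0}"
    using continuous_open_preimage[OF h U open_greaterThan[of 0]]
    by (simp add: vimage_def Int_def greaterThan_def)
  then obtain r where r: "r > 0" "cball z0 r \<subseteq> {z \<in> U. h z > 0}"
    using z0 h0 open_contains_cball by (metis (mono_tags, lifting) mem_Collect_eq)
  define \<phi> where "\<phi> z = cnj (X z0) * complex_of_real (bump z0 r z)" for z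
  have bp: "bump z0 r z \<ge> 0" for z
    by (simp add: bump_def flat_nonneg)
  have bpos: "bump z0 r z > 0 \<longleftrightarrow> z \<in> ball z0 r" for z
  proof -
    have "bump z0 r z > 0 \<longleftrightarrow> (cmod (z - z0))\<^sup>2 < r\<^sup>2"
      by (simp add: bump_def flat_def)
    also have "\<dots> \<longleftrightarrow> cmod (z - z0) < r"
      using r(1) power2_less_imp_less[of "cmod (z - z0)" r] by (auto intro: power_strict_mono)
    finally show ?thesis by (simp add: dist_norm norm_minus_commute)
  qed
  have eq: "Re (\<phi> z * X z) = bump z0 r z * h z" for z
    by (simp add: \<phi>_def h_def algebra_simps)
  have smooth: "smooth_on \<phi> UNIV"
    unfolding \<phi>_def by (rule smooth_on_bump)
  have cont: "continuous_on (cball z0 r) (\<lambda>z. Re (\<phi> z * X z))"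
    using r smooth[unfolded smooth_on_def, rule_format, of 0]
    by (intro continuous_intros continuous_on_subset[OF X]) (auto intro: continuous_on_subset)
  have "(LINT z:cball z0 r|lborel. Re (\<phi> z * X z)) > 0"
  proof -
    have int: "integrable lborel (\<lambda>z. indicator (cball z0 r) z *\<^sub>R Re (\<phi> z * X z))"
      by (rule borel_integrable_compact[OF compact_cball cont])
    have nonneg: "0 \<le> indicator (cball z0 r) z *\<^sub>R Re (\<phi> z * X z)" for z
    proof (cases "z \<in> cball z0 r")
      case True
      then have "h z > 0" using r by auto
      then show ?thesis using True bp[of z] unfolding eq by simp
    qed simp
    have "\<not> (AE z in lborel. indicator (cball z0 r) z *\<^sub>R Re (\<phi> z * X z) = 0)"
    proof
      assume "AE z in lborel. indicator (cball z0 r) z *\<^sub>R Re (\<phi> z * X z) = 0"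
      then have "AE z in lborel. z \<notin> ball z0 r"
      proof eventually_elim
        case (elim z)
        show ?case
        proof
          assume "z \<in> ball z0 r"
          then have b: "bump z0 r z > 0" "z \<in> cball z0 r"
            using bpos by auto
          then have "h z > 0" using r by blast
          then show False using elim b unfolding eq by simp
        qed
      qed
      then have "emeasure lborel (ball z0 r) = 0"
        by (subst (asm) AE_iff_measurable[OF _ refl]) (auto simp: ball_def)
      then show False
        using content_ball_pos[OF r(1), of z0] by (simp add: measure_def)
    qed
    then have "(LINT z|lborel. indicator (cball z0 r) z *\<^sub>R Re (\<phi> z * X z)) \<noteq> 0"
      using integral_nonneg_eq_0_iff_AE[OF int] nonneg by simp
    moreover have "(LINT z|lborel. indicator (cball z0 r) z *\<^sub>R Re (\<phi> z * X z)) \<ge> 0"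
      by (intro integral_nonneg_AE AE_I2 nonneg)
    ultimately show ?thesis
      unfolding set_lebesgue_integral_def by linarith
  qed
  moreover have "\<phi> z = 0" if "z \<notin> cball z0 r" for z
  proof -
    have "\<not> bump z0 r z > 0" using that bpos[of z] by auto
    then show ?thesis using bp[of z] by (simp add: \<phi>_def)
  qed
  ultimately show ?thesis
    using that[OF smooth compact_cball] r by blast
qed

section \<open>Wirtinger calculus\<close>

lemma wirt_eqI: "(f has_derivative D) (at z) \<Longrightarrow> wirt f z = (D 1 - \<i> * D \<i>) / 2"
  by (simp add: wirt_def frechet_derivative_at[symmetric])

lemma wirt_add:
  assumes "f differentiable (at z)" "g differentiable (at z)"
  shows "wirt (\<lambda>z. f z + g z) z = wirt f z + wirt g z"
  unfolding wirt_eqI[OF has_derivative_add[OF assms[unfolded frechet_derivative_works]]] wirt_def[of f] wirt_def[of g]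
  by (simp add: field_simps)

lemma wirt_mult:
  assumes "f differentiable (at z)" "g differentiable (at z)"
  shows "wirt (\<lambda>z. f z * g z) z = f z * wirt g z + g z * wirt f z"
  unfolding wirt_eqI[OF has_derivative_mult[OF assms[unfolded frechet_derivative_works]]] wirt_def[of f] wirt_def[of g]
  by (simp add: field_simps)

lemma wirt_cmult:
  assumes "f differentiable (at z)"
  shows "wirt (\<lambda>z. c * f z) z = c * wirt f z"
  unfolding wirt_eqI[OF has_derivative_mult_right[OF assms[unfolded frechet_derivative_works]]] wirt_def[of f]
  by (simp add: field_simps)

lemma differentiable_cnj:
  fixes f :: "complex \<Rightarrow> complex"
  shows "f differentiable (at z) \<Longrightarrow> (\<lambda>z. cnj (f z)) differentiable (at z)"
  unfolding differentiable_def by (auto intro: has_derivative_cnj)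

lemma Ck_on_wirt:
  assumes "open U" "Ck_on (Suc n) f U"
  shows "Ck_on n (wirt f) U"
proof -
  have "Ck_on n (\<lambda>z. (1 / 2) * frechet_derivative f (at z) 1 + (- \<i> / 2) * frechet_derivative f (at z) \<i>) U"
    by (intro Ck_on_add Ck_on_mult Ck_on_const assms Ck_on_SucD(2)[OF assms(2)])
  then show ?thesis
    by (subst Ck_on_cong[OF assms(1)]) (auto simp: wirt_def field_simps)
qed

lemma Ck_on_le:
  assumes "Ck_on n f U" "m \<le> n"
  shows "Ck_on m f U"
  using assms(2,1) by (induction rule: dec_induct) (auto dest: Ck_on_Suc_imp simp del: Ck_on.simps)

section \<open>The conformal factor\<close>

lemma one_plus_norm_sq_pos: "1 + (cmod z)\<^sup>2 > 0"
  by (simp add: add_pos_nonneg)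

lemma e2u_pos: "e2u z > 0"
  using one_plus_norm_sq_pos[of z] by (simp add: e2u_def)

lemma Ck_on_inverse_one_plus_norm_sq:
  "Ck_on n (\<lambda>z. complex_of_real (inverse (1 + (cmod z)\<^sup>2))) UNIV"
proof (induction n)
  case 0
  have "1 + (cmod z)\<^sup>2 \<noteq> 0" for z using one_plus_norm_sq_pos[of z] by simp
  then have "continuous_on UNIV (\<lambda>z::complex. inverse (1 + (cmod z)\<^sup>2))"
    by (intro continuous_intros) auto
  then show ?case by (simp add: continuous_on_of_real del: of_real_inverse)
next
  case (Suc n)
  let ?r = "\<lambda>z. inverse (1 + (cmod z)\<^sup>2)"
  have D: "((\<lambda>z. complex_of_real (?r z)) has_derivative
      (\<lambda>v. complex_of_real (- (2 * (z \<bullet> v)) * (?r z * ?r z)))) (at z)" for z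
  proof (rule has_derivative_of_real)
    have "1 + (cmod z)\<^sup>2 \<noteq> 0" using one_plus_norm_sq_pos[of z] by simp
    moreover have "((\<lambda>z. 1 + (cmod z)\<^sup>2) has_derivative (\<lambda>v. 2 * (z \<bullet> v))) (at z)"
      unfolding power2_norm_eq_inner
      by (auto intro!: derivative_eq_intros simp: inner_commute)
    ultimately show "(?r has_derivative (\<lambda>v. - (2 * (z \<bullet> v)) * (?r z * ?r z))) (at z)"
      by (auto intro!: derivative_eq_intros)
  qed
  have "Ck_on n (\<lambda>z. complex_of_real (- (2 * (z \<bullet> v))) * (complex_of_real (?r z) * complex_of_real (?r z))) UNIV" for v
    by (intro Ck_on_mult Suc.IH open_UNIV Ck_on_bounded_linear[OF bounded_linear_compose[OF bounded_linear_of_real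
            bounded_linear_minus[OF bounded_linear_const_mult[OF bounded_linear_inner_left]]]])
  then show ?case
    by (intro Ck_on_SucI[OF open_UNIV D]) simp
qed

lemma Ck_on_e2u: "Ck_on n (\<lambda>z. complex_of_real (e2u z)) UNIV"
proof -
  let ?r = "\<lambda>z. complex_of_real (inverse (1 + (cmod z)\<^sup>2))"
  have "Ck_on n (\<lambda>z. 4 * (?r z * ?r z)) UNIV"
    by (intro Ck_on_mult Ck_on_const Ck_on_inverse_one_plus_norm_sq open_UNIV)
  then show ?thesis
    by (simp add: e2u_def divide_inverse power2_eq_square)
qed

lemma Ck_on_inverse_e2u: "Ck_on n (\<lambda>z. inverse (complex_of_real (e2u z))) UNIV"
proof -
  have "Ck_on n (\<lambda>z. (1 / 4) * ((1 + z * cnj z) * (1 + z * cnj z))) UNIV"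
    by (intro Ck_on_mult Ck_on_const Ck_on_add Ck_on_cnj open_UNIV Ck_on_bounded_linear[OF bounded_linear_ident])
  moreover have "(1 / 4) * ((1 + z * cnj z) * (1 + z * cnj z)) = inverse (complex_of_real (e2u z))" for z
    by (simp add: e2u_def power2_eq_square complex_norm_square[symmetric])
  ultimately show ?thesis by simp
qed

section \<open>The Euler-Lagrange equation of the area functional\<close>

text \<open>
  The determinant \<open>\<Delta>\<close> of the induced metric, up to the factor \<open>e\<^bsup>4u\<^esup>\<close>; see \<open>induced_det_eq\<close>.
\<close>

definition disc :: "(complex \<Rightarrow> complex) \<Rightarrow> complex \<Rightarrow> real" where
  "disc F z = (twist F z)\<^sup>2 - (cmod (shear F z))\<^sup>2"

text \<open>
  Twice the derivative of \<open>|\<Delta>|\<^bsup>1/2\<^esup>\<close> with respect to \<open>\<Delta>\<close>.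
\<close>

definition inv_sqrt_disc :: "(complex \<Rightarrow> complex) \<Rightarrow> complex \<Rightarrow> real" where
  "inv_sqrt_disc F z = sgn (disc F z) / sqrt \<bar>disc F z\<bar>"

text \<open>
  The twist flux and the shear flux are the coefficients of \<open>\<partial>(\<phi> e\<^bsup>2u\<^esup>)\<close> and of \<open>\<partial> \<phi>\<^sup>-\<close> in the
  first variation of the area.
\<close>

definition twist_flux :: "(complex \<Rightarrow> complex) \<Rightarrow> complex \<Rightarrow> complex" where
  "twist_flux F z = complex_of_real (inv_sqrt_disc F z * twist F z)"

definition shear_flux :: "(complex \<Rightarrow> complex) \<Rightarrow> complex \<Rightarrow> complex" where
  "shear_flux F z = complex_of_real (e2u z * inv_sqrt_disc F z) * cnj (shear F z)"

text \<open>
  The first summand is \<open>\<partial>\<^sup>- (e\<^bsup>2u\<^esup> w \<sigma>)\<close>, written with the Wirtinger derivative of the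
  conjugate function.
\<close>

definition euler_lagrange :: "(complex \<Rightarrow> complex) \<Rightarrow> complex \<Rightarrow> complex" where
  "euler_lagrange F z = cnj (wirt (shear_flux F) z) - \<i> * complex_of_real (e2u z) * wirt (twist_flux F) z"

lemma disc_nonzero:
  assumes "Ck_on (Suc n) F U" "nondegenerate_graph F U" "z \<in> U"
  shows "disc F z \<noteq> 0"
  using induced_det_eq[of F z] assms by (auto simp: nondegenerate_graph_def disc_def)

lemma Ck_on_shear:
  assumes "open U" "Ck_on (Suc n) F U"
  shows "Ck_on n (shear F) U"
proof -
  have "Ck_on n (\<lambda>z. (- 1) * wirt (\<lambda>z. cnj (F z)) z) U"
    by (intro Ck_on_mult Ck_on_const Ck_on_wirt Ck_on_cnj assms)
  then show ?thesis by (simp add: shear_def[abs_def])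
qed

lemma Ck_on_twist:
  assumes "open U" "Ck_on (Suc n) F U"
  shows "Ck_on n (\<lambda>z. complex_of_real (twist F z)) U"
proof -
  have "Ck_on n (\<lambda>z. wirt (\<lambda>z. F z * complex_of_real (e2u z)) z * inverse (complex_of_real (e2u z))) U"
    by (intro Ck_on_mult Ck_on_wirt assms Ck_on_subset[OF Ck_on_e2u] Ck_on_subset[OF Ck_on_inverse_e2u]) auto
  from Ck_on_of_real_Im[OF assms(1) this] show ?thesis
    by (simp add: twist_def rho_def divide_inverse)
qed

lemma Ck_on_disc:
  assumes "open U" "Ck_on (Suc n) F U"
  shows "Ck_on n (\<lambda>z. complex_of_real (disc F z)) U"
proof -
  have "Ck_on n (\<lambda>z. complex_of_real (twist F z) * complex_of_real (twist F z) + (- 1) * (shear F z * cnj (shear F z))) U"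
    by (intro Ck_on_add Ck_on_mult Ck_on_const Ck_on_cnj Ck_on_twist Ck_on_shear assms)
  then show ?thesis
    unfolding disc_def of_real_diff complex_norm_square by (simp add: power2_eq_square)
qed

lemma sgn_div_sqrt_has_derivative:
  fixes x :: real
  assumes "x \<noteq> 0"
  shows "((\<lambda>x. sgn x / sqrt \<bar>x\<bar>) has_real_derivative - 1 / (2 * \<bar>x\<bar> * sqrt \<bar>x\<bar>)) (at x)"
proof -
  consider "x > 0" | "x < 0" using assms by linarith
  then show ?thesis
  proof cases
    case 1
    have "((\<lambda>x. 1 / sqrt x) has_real_derivative - 1 / (2 * \<bar>x\<bar> * sqrt \<bar>x\<bar>)) (at x)"
      using 1 by (auto intro!: derivative_eq_intros simp: field_simps)
    then show ?thesis
      by (rule has_field_derivative_transform_within_open[where S = "{0<..}"]) (use 1 in auto)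
  next
    case 2
    have "((\<lambda>x. - 1 / sqrt (- x)) has_real_derivative - 1 / (2 * \<bar>x\<bar> * sqrt \<bar>x\<bar>)) (at x)"
      using 2 by (auto intro!: derivative_eq_intros simp: field_simps)
    then show ?thesis
      by (rule has_field_derivative_transform_within_open[where S = "{..<0}"]) (use 2 in auto)
  qed
qed

lemma Ck_on_2D:
  assumes "Ck_on 2 F U"
  shows "Ck_on (Suc 1) F U" "Ck_on (Suc 0) F U"
  using assms Ck_on_le[OF assms, of 1] by (simp_all only: numeral_2_eq_2 One_nat_def)

context
  fixes F :: "complex \<Rightarrow> complex" and U :: "complex set"
  assumes U: "open U" and F: "Ck_on 2 F U" and nondeg: "nondegenerate_graph F U"
begin

lemma Ck_on_inv_sqrt_disc: "Ck_on 1 (\<lambda>z. complex_of_real (inv_sqrt_disc F z)) U"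
  unfolding inv_sqrt_disc_def
proof (rule C1_on_compose_real[OF U Ck_on_disc[OF U Ck_on_2D(1)[OF F]]])
  note nz = disc_nonzero[OF Ck_on_2D(1)[OF F] nondeg]
  show "((\<lambda>x. sgn x / sqrt \<bar>x\<bar>) has_real_derivative - 1 / (2 * \<bar>disc F z\<bar> * sqrt \<bar>disc F z\<bar>)) (at (disc F z))"
    if "z \<in> U" for z
    by (rule sgn_div_sqrt_has_derivative[OF nz[OF that]])
  show "continuous_on (disc F ` U) (\<lambda>x. - 1 / (2 * \<bar>x\<bar> * sqrt \<bar>x\<bar>))"
    by (intro continuous_intros) (use nz in auto)
qed

lemma Ck_on_twist_flux: "Ck_on 1 (twist_flux F) U"
  using Ck_on_mult[OF U Ck_on_inv_sqrt_disc Ck_on_twist[OF U Ck_on_2D(1)[OF F]]]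
  by (simp add: twist_flux_def[abs_def] del: Ck_on.simps One_nat_def)

lemma Ck_on_shear_flux: "Ck_on 1 (shear_flux F) U"
  using Ck_on_mult[OF U Ck_on_mult[OF U Ck_on_subset[OF Ck_on_e2u subset_UNIV] Ck_on_inv_sqrt_disc] Ck_on_cnj[OF U Ck_on_shear[OF U Ck_on_2D(1)[OF F]]]]
  by (simp add: shear_flux_def[abs_def] del: Ck_on.simps One_nat_def)

lemma continuous_on_euler_lagrange: "continuous_on U (euler_lagrange F)"
proof -
  have "continuous_on U (wirt (shear_flux F))" "continuous_on U (wirt (twist_flux F))"
    using Ck_on_wirt[OF U, of 0] Ck_on_twist_flux Ck_on_shear_flux by simp_all
  moreover have "continuous_on U (\<lambda>z. complex_of_real (e2u z))"
    using Ck_on_imp_continuous_on[OF Ck_on_subset[OF Ck_on_e2u subset_UNIV]] .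
  ultimately show ?thesis
    unfolding euler_lagrange_def[abs_def]
    by (intro continuous_on_diff continuous_on_mult continuous_on_cnj continuous_on_const)
qed

end

lemma twist_mult_e2u: "twist F z * e2u z = Im (wirt (\<lambda>z. F z * complex_of_real (e2u z)) z)"
  using e2u_pos[of z] by (simp add: twist_def rho_def)

lemma shear_perturb:
  assumes "F differentiable (at z)" "\<phi> differentiable (at z)"
  shows "shear (\<lambda>z. F z + complex_of_real t * \<phi> z) z = shear F z + complex_of_real t * shear \<phi> z"
proof -
  note d = differentiable_cnj[OF assms(1)] differentiable_cnj[OF assms(2)]
  have "(\<lambda>z. complex_of_real t * cnj (\<phi> z)) differentiable (at z)"
    by (intro differentiable_mult differentiable_const d)
  from wirt_add[OF d(1) this] show ?thesis
    by (simp add: shear_def wirt_cmult[OF d(2)])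
qed

lemma twist_perturb:
  assumes "F differentiable (at z)" "\<phi> differentiable (at z)"
  shows "twist (\<lambda>z. F z + complex_of_real t * \<phi> z) z = twist F z + t * twist \<phi> z"
proof -
  let ?E = "\<lambda>z. complex_of_real (e2u z)"
  have d: "(\<lambda>z. F z * ?E z) differentiable (at z)" "(\<lambda>z. \<phi> z * ?E z) differentiable (at z)"
    using assms e2u_differentiable by (auto intro: differentiable_mult)
  have "wirt (\<lambda>z. (F z + complex_of_real t * \<phi> z) * ?E z) z
      = wirt (\<lambda>z. F z * ?E z + complex_of_real t * (\<phi> z * ?E z)) z"
    by (simp add: algebra_simps)
  also have "\<dots> = wirt (\<lambda>z. F z * ?E z) z + complex_of_real t * wirt (\<lambda>z. \<phi> z * ?E z) z"
    by (subst wirt_add) (use d in \<open>auto intro: differentiable_mult simp: wirt_cmult\<close>)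
  finally show ?thesis
    using e2u_pos[of z] by (simp add: twist_def rho_def field_simps)
qed

lemma disc_perturb:
  assumes "F differentiable (at z)" "\<phi> differentiable (at z)"
  shows "disc (\<lambda>z. F z + complex_of_real t * \<phi> z) z =
    disc F z + 2 * t * (twist F z * twist \<phi> z - Re (cnj (shear F z) * shear \<phi> z)) + t\<^sup>2 * disc \<phi> z"
  unfolding disc_def twist_perturb[OF assms] shear_perturb[OF assms] cmod_power2
  by (simp add: power2_eq_square algebra_simps)

lemma area_eq: "area F K = (LINT z:K|lborel. sqrt \<bar>disc F z\<bar> * (e2u z * 2))"
  by (simp add: area_def disc_def mult.assoc)

text \<open>
  The factor \<open>g\<close> removes whatever values \<open>f\<close> has outside \<open>U\<close>, so the product is regular on
  the whole plane although \<open>f\<close> need not be.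
\<close>

lemma Ck_on_mult_cutoff:
  assumes U: "open U" and f: "Ck_on n f U" and g: "Ck_on n g UNIV"
    and K: "compact K" "K \<subseteq> U" and supp: "\<And>z. z \<notin> K \<Longrightarrow> g z = 0"
  shows "Ck_on n (\<lambda>z. f z * g z) UNIV"
proof -
  have o: "open (- K)" using K by (simp add: compact_imp_closed open_Compl)
  have "Ck_on n (\<lambda>z. f z * g z) U"
    by (rule Ck_on_mult[OF U f Ck_on_subset[OF g]]) simp
  moreover have "Ck_on n (\<lambda>z. f z * g z) (- K)"
    by (subst Ck_on_cong[OF o, of _ "\<lambda>_. 0"]) (use supp in \<open>auto intro: Ck_on_const\<close>)
  ultimately have "Ck_on n (\<lambda>z. f z * g z) (U \<union> - K)"
    by (rule Ck_on_Un[OF U o])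
  moreover have "U \<union> - K = UNIV" using K by auto
  ultimately show ?thesis by simp
qed

lemma integral_wirt_eq_0:
  assumes f: "Ck_on 1 f UNIV" and K: "compact K" and supp: "\<And>z. z \<notin> K \<Longrightarrow> f z = 0"
  shows "(LINT z:K|lborel. wirt f z) = 0" and "set_integrable lborel K (wirt f)"
proof -
  let ?D = "\<lambda>v z. frechet_derivative f (at z) v"
  have cont: "continuous_on K (?D v)" for v
    using Ck_on_SucD(2)[OF f[unfolded One_nat_def], of v] continuous_on_subset by auto
  have zero: "(LINT z:K|lborel. ?D v z) = 0" for v
  proof -
    have "indicator K z *\<^sub>R ?D v z = ?D v z" for z
      using frechet_derivative_eq_0_outside_support[OF compact_imp_closed[OF K] supp]
      by (auto simp: indicator_def)
    then show ?thesis
      unfolding set_lebesgue_integral_def using integral_frechet_derivative_eq_0[OF f K supp, of v] by simp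
  qed
  have int: "set_integrable lborel K (?D v)" for v
    unfolding set_integrable_def by (rule borel_integrable_compact[OF K cont])
  have w: "wirt f = (\<lambda>z. (1 / 2) * ?D 1 z - (\<i> / 2) * ?D \<i> z)"
    by (auto simp: wirt_def field_simps)
  have i: "set_integrable lborel K (\<lambda>z. c * ?D v z)" for c v
    by (rule set_integrable_mult_right) (rule int)
  show "set_integrable lborel K (wirt f)"
    unfolding w by (rule set_integral_diff(1)[OF i i])
  show "(LINT z:K|lborel. wirt f z) = 0"
    unfolding w set_integral_diff(2)[OF i i] set_integral_mult_right zero by simp
qed

lemma set_integral_Re:
  assumes "set_integrable M A f"
  shows "(LINT z:A|M. Re (f z)) = Re (LINT z:A|M. f z)"
  using integral_Re[OF assms[unfolded set_integrable_def]] by (simp add: set_lebesgue_integral_def)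

lemma set_integral_Im:
  assumes "set_integrable M A f"
  shows "(LINT z:A|M. Im (f z)) = Im (LINT z:A|M. f z)"
  using integral_Im[OF assms[unfolded set_integrable_def]] by (simp add: set_lebesgue_integral_def)

text \<open>
  The derivative of the density is \<open>2 e\<^bsup>2u\<^esup> w (\<lambda> \<lambda>\<^sub>\<phi> - Re (\<sigma>\<^sup>- \<sigma>\<^sub>\<phi>))\<close>, a superscript minus
  denoting the conjugate and the subscript the twist and the shear of \<open>\<phi>\<close>. Since
  \<open>e\<^bsup>2u\<^esup> \<lambda>\<^sub>\<phi> = Im \<partial>(\<phi> e\<^bsup>2u\<^esup>)\<close> and \<open>\<sigma>\<^sub>\<phi> = - \<partial> \<phi>\<^sup>-\<close>, the product rule separates it into
  derivatives of compactly supported functions and \<open>- 2 Re (\<phi> X)\<close>.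
\<close>

lemma first_variation_of_area:
  assumes U: "open U" and F: "Ck_on 2 F U" and nondeg: "nondegenerate_graph F U"
    and \<phi>: "smooth_on \<phi> UNIV" and K: "compact K" "K \<subseteq> U" and supp: "\<And>z. z \<notin> K \<Longrightarrow> \<phi> z = 0"
  shows "((\<lambda>t. area (\<lambda>z. F z + complex_of_real t * \<phi> z) K) has_real_derivative
            - 2 * (LINT z:K|lborel. Re (\<phi> z * euler_lagrange F z))) (at 0)"
proof -
  let ?E = "\<lambda>z. complex_of_real (e2u z)"
  define b where "b z = twist F z * twist \<phi> z - Re (cnj (shear F z) * shear \<phi> z)" for z
  note F' = Ck_on_2D[OF F]
  have \<phi>': "Ck_on n \<phi> UNIV" for n using \<phi> by (simp add: smooth_on_def)
  have \<phi>'': "Ck_on n \<phi> U" for n by (rule Ck_on_subset[OF \<phi>']) simp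
  have d: "F differentiable (at z)" "\<phi> differentiable (at z)" if "z \<in> U" for z
    using F'(2) \<phi>'[of 1] that by auto
  have Kb: "K \<in> sets lborel" using K by (simp add: compact_imp_closed borel_closed)
  have cE: "continuous_on K e2u"
    using Ck_on_imp_continuous_on[OF Ck_on_subset[OF Ck_on_e2u subset_UNIV], of K] by simp
  have c: "continuous_on U (twist G)" "continuous_on U (disc G)" "continuous_on U (shear G)"
    if "Ck_on (Suc 0) G U" for G
    using Ck_on_imp_continuous_on[OF Ck_on_twist[OF U that]] Ck_on_imp_continuous_on[OF Ck_on_disc[OF U that]]
      Ck_on_imp_continuous_on[OF Ck_on_shear[OF U that]] by simp_all
  note cF = c[OF F'(2), THEN continuous_on_subset, OF K(2)]
  note c\<phi> = c[OF \<phi>'', THEN continuous_on_subset, OF K(2)]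
  have cb: "continuous_on K b"
    unfolding b_def by (intro continuous_intros cF c\<phi>)
  have eq1: "area (\<lambda>z. F z + complex_of_real t * \<phi> z) K
      = (LINT z:K|lborel. sqrt \<bar>disc F z + 2 * t * b z + t\<^sup>2 * disc \<phi> z\<bar> * (e2u z * 2))" for t
    unfolding area_eq
    by (rule set_lebesgue_integral_cong[OF Kb]) (use d K in \<open>auto simp: disc_perturb b_def\<close>)
  have "((\<lambda>t. area (\<lambda>z. F z + complex_of_real t * \<phi> z) K) has_real_derivative
      (LINT z:K|lborel. sgn (disc F z) / sqrt \<bar>disc F z\<bar> * b z * (e2u z * 2))) (at 0)"
    unfolding eq1
    by (rule first_variation_of_sqrt_integral[OF K(1) cF(2) cb c\<phi>(2)])
       (use disc_nonzero[OF F'(1) nondeg] K in \<open>auto intro!: continuous_intros cE\<close>)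
  moreover have "(LINT z:K|lborel. sgn (disc F z) / sqrt \<bar>disc F z\<bar> * b z * (e2u z * 2))
      = - 2 * (LINT z:K|lborel. Re (\<phi> z * euler_lagrange F z))"
  proof -
    let ?Y = "twist_flux F" and ?Z = "shear_flux F"
    let ?\<psi> = "\<lambda>z. \<phi> z * ?E z"
    have C\<psi>: "Ck_on 1 ?\<psi> UNIV" by (intro Ck_on_mult \<phi>' Ck_on_e2u open_UNIV)
    have Cc: "Ck_on 1 (\<lambda>z. cnj (\<phi> z)) UNIV" by (intro Ck_on_cnj \<phi>' open_UNIV)
    note CY = Ck_on_twist_flux[OF U F nondeg] and CZ = Ck_on_shear_flux[OF U F nondeg]
    have Y\<psi>: "Ck_on 1 (\<lambda>z. ?Y z * ?\<psi> z) UNIV"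
      by (rule Ck_on_mult_cutoff[OF U CY C\<psi> K]) (simp add: supp)
    have Zc: "Ck_on 1 (\<lambda>z. ?Z z * cnj (\<phi> z)) UNIV"
      by (rule Ck_on_mult_cutoff[OF U CZ Cc K]) (simp add: supp)
    have int1: "(LINT z:K|lborel. wirt (\<lambda>z. ?Y z * ?\<psi> z) z) = 0"
      "set_integrable lborel K (wirt (\<lambda>z. ?Y z * ?\<psi> z))"
      using integral_wirt_eq_0[OF Y\<psi> K(1)] by (simp_all add: supp)
    have int2: "(LINT z:K|lborel. wirt (\<lambda>z. ?Z z * cnj (\<phi> z)) z) = 0"
      "set_integrable lborel K (wirt (\<lambda>z. ?Z z * cnj (\<phi> z)))"
      using integral_wirt_eq_0[OF Zc K(1)] by (simp_all add: supp)
    have int3: "set_integrable lborel K (\<lambda>z. Re (\<phi> z * euler_lagrange F z))"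
      unfolding set_integrable_def
      by (intro borel_integrable_compact K continuous_intros
          continuous_on_subset[OF continuous_on_euler_lagrange[OF U F nondeg]]
          continuous_on_subset[OF Ck_on_imp_continuous_on[OF \<phi>'[of 0]]]) (use K in auto)
    \<comment> \<open>The two Wirtinger derivatives on the right integrate to 0.\<close>
    have pt: "sgn (disc F z) / sqrt \<bar>disc F z\<bar> * b z * (e2u z * 2)
        = 2 * Im (wirt (\<lambda>z. ?Y z * ?\<psi> z) z) + 2 * Re (wirt (\<lambda>z. ?Z z * cnj (\<phi> z)) z)
          - 2 * Re (\<phi> z * euler_lagrange F z)" if z: "z \<in> U" for z
    proof -
      have w1: "wirt (\<lambda>z. ?Y z * ?\<psi> z) z = ?Y z * wirt ?\<psi> z + ?\<psi> z * wirt ?Y z"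
        by (rule wirt_mult) (use CY C\<psi> z in auto)
      have w2: "wirt (\<lambda>z. ?Z z * cnj (\<phi> z)) z = ?Z z * - shear \<phi> z + cnj (\<phi> z) * wirt ?Z z"
        unfolding shear_def minus_minus by (rule wirt_mult) (use CZ Cc z in auto)
      have i: "Im (?Y z * wirt ?\<psi> z) = inv_sqrt_disc F z * twist F z * (twist \<phi> z * e2u z)"
        unfolding twist_mult_e2u by (simp add: twist_flux_def)
      have r: "Re (?Z z * - shear \<phi> z) = - (e2u z * inv_sqrt_disc F z * Re (cnj (shear F z) * shear \<phi> z))"
        by (simp add: shear_flux_def algebra_simps)
      have e: "Re (\<phi> z * euler_lagrange F z) = Im (?\<psi> z * wirt ?Y z) + Re (cnj (\<phi> z) * wirt ?Z z)"
        by (simp add: euler_lagrange_def algebra_simps)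
      show ?thesis
        unfolding w1 w2 plus_complex.sel i r e by (simp add: inv_sqrt_disc_def b_def algebra_simps)
    qed
    let ?I = "\<lambda>z. Im (wirt (\<lambda>z. ?Y z * ?\<psi> z) z)" and ?R = "\<lambda>z. Re (wirt (\<lambda>z. ?Z z * cnj (\<phi> z)) z)"
    have sI: "set_integrable lborel K ?I" and sR: "set_integrable lborel K ?R"
      using integrable_Im[OF int1(2)[unfolded set_integrable_def]] integrable_Re[OF int2(2)[unfolded set_integrable_def]]
      by (simp_all add: set_integrable_def)
    have I0: "(LINT z:K|lborel. ?I z) = 0" and R0: "(LINT z:K|lborel. ?R z) = 0"
      using set_integral_Im[OF int1(2)] set_integral_Re[OF int2(2)] int1(1) int2(1) by simp_all
    have m: "set_integrable lborel K (\<lambda>z. 2 * f z)" if "set_integrable lborel K f" for f :: "complex \<Rightarrow> real"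
      using that by (intro set_integrable_mult_right)
    have "(LINT z:K|lborel. sgn (disc F z) / sqrt \<bar>disc F z\<bar> * b z * (e2u z * 2))
        = (LINT z:K|lborel. 2 * ?I z + 2 * ?R z - 2 * Re (\<phi> z * euler_lagrange F z))"
      by (rule set_lebesgue_integral_cong[OF Kb]) (use pt K in blast)
    also have "\<dots> = - 2 * (LINT z:K|lborel. Re (\<phi> z * euler_lagrange F z))"
      unfolding set_integral_diff(2)[OF set_integral_add(1)[OF m[OF sI] m[OF sR]] m[OF int3]]
        set_integral_add(2)[OF m[OF sI] m[OF sR]] set_integral_mult_right I0 R0 by simp
    finally show ?thesis .
  qed
  ultimately show ?thesis by simp
qed

theorem area_stationary_iff_euler_lagrange:
  assumes U: "open U" and F: "Ck_on 2 F U" and nondeg: "nondegenerate_graph F U"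
  shows "area_stationary F U \<longleftrightarrow> (\<forall>z\<in>U. euler_lagrange F z = 0)"
proof
  assume st: "area_stationary F U"
  show "\<forall>z\<in>U. euler_lagrange F z = 0"
  proof (rule ballI, rule ccontr)
    fix z assume z: "z \<in> U" and "euler_lagrange F z \<noteq> 0"
    from fundamental_lemma_of_variations[OF U continuous_on_euler_lagrange[OF assms] this]
    obtain \<phi> K where *: "smooth_on \<phi> UNIV" "compact K" "K \<subseteq> U" "\<And>z. z \<notin> K \<Longrightarrow> \<phi> z = 0"
      and pos: "(LINT z:K|lborel. Re (\<phi> z * euler_lagrange F z)) > 0"
      by blast
    have "((\<lambda>t. area (\<lambda>z. F z + complex_of_real t * \<phi> z) K) has_real_derivative 0) (at 0)"
      using st * unfolding area_stationary_def by blast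
    with first_variation_of_area[OF assms *] pos show False
      using DERIV_unique by fastforce
  qed
next
  assume el: "\<forall>z\<in>U. euler_lagrange F z = 0"
  show "area_stationary F U"
    unfolding area_stationary_def
  proof (intro allI impI)
    fix \<phi> K
    assume *: "smooth_on \<phi> UNIV \<and> compact K \<and> K \<subseteq> U \<and> (\<forall>z. z \<notin> K \<longrightarrow> \<phi> z = 0)"
    have "(LINT z:K|lborel. Re (\<phi> z * euler_lagrange F z)) = (LINT z:K|lborel. 0)"
      using * el by (intro set_lebesgue_integral_cong) (auto simp: compact_imp_closed borel_closed subset_iff)
    with first_variation_of_area[OF assms, of \<phi> K] *
    show "((\<lambda>t. area (\<lambda>z. F z + complex_of_real t * \<phi> z) K) has_real_derivative 0) (at 0)"
      by simp
  qed
qed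

section \<open>Rotational symmetry\<close>

definition rotation_invariant :: "complex set \<Rightarrow> bool" where
  "rotation_invariant U \<longleftrightarrow> (\<forall>z\<in>U. \<forall>C. z * cis C \<in> U)"

text \<open>
  The number \<open>k\<close> is the weight: 1 for \<open>F\<close>, 0 for the twist and -2 for the shear.
\<close>

definition equivariant :: "real \<Rightarrow> (complex \<Rightarrow> complex) \<Rightarrow> complex set \<Rightarrow> bool" where
  "equivariant k H U \<longleftrightarrow> (\<forall>z\<in>U. \<forall>C. H (z * cis C) = cis (k * C) * H z)"

lemma equivariantD: "equivariant k H U \<Longrightarrow> z \<in> U \<Longrightarrow> H (z * cis C) = cis (k * C) * H z"
  by (simp add: equivariant_def)

lemma e2u_rotate: "e2u (z * cis C) = e2u z"
  by (simp add: e2u_def norm_mult)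

lemma rotationally_symmetric_graphD:
  assumes "rotationally_symmetric (graph F U)"
  shows "rotation_invariant U" "equivariant 1 F U"
proof -
  have "z * cis C \<in> U \<and> F (z * cis C) = F z * cis C" if "z \<in> U" for z C
  proof -
    have "rotation C (z, F z) \<in> rotation C ` graph F U"
      using that by (auto simp: graph_def)
    then have "(z * cis C, F z * cis C) \<in> graph F U"
      using assms by (simp add: rotationally_symmetric_def rotation_def)
    then show ?thesis by (auto simp: graph_def)
  qed
  then show "rotation_invariant U" "equivariant 1 F U"
    by (auto simp: rotation_invariant_def equivariant_def mult.commute)
qed

lemma equivariant_cnj: "equivariant k H U \<Longrightarrow> equivariant (- k) (\<lambda>z. cnj (H z)) U"
  by (simp add: equivariant_def cis_cnj)

lemma equivariant_mult:
  "equivariant k H U \<Longrightarrow> equivariant l G U \<Longrightarrow> equivariant (k + l) (\<lambda>z. H z * G z) U"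
  unfolding equivariant_def distrib_right cis_mult[symmetric] by simp

lemma equivariant_e2u: "equivariant 0 (\<lambda>z. complex_of_real (e2u z)) U"
  by (simp add: equivariant_def e2u_rotate)

text \<open>
  The chain rule for the rotation \<open>z \<mapsto> z a\<close> contributes the factor \<open>a\<close>, which lowers the
  weight by one.
\<close>

lemma equivariant_wirt:
  assumes U: "open U" "rotation_invariant U" and H: "equivariant k H U"
    and d: "\<And>z. z \<in> U \<Longrightarrow> H differentiable (at z)"
  shows "equivariant (k - 1) (wirt H) U"
  unfolding equivariant_def
proof (intro ballI allI)
  fix z C assume z: "z \<in> U"
  define a where "a = cis C"
  define L where "L = frechet_derivative H (at (z * a))"
  have za: "z * a \<in> U" using U(2) z by (simp add: rotation_invariant_def a_def)
  have L: "(H has_derivative L) (at (z * a))"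
    using d[OF za] by (simp add: frechet_derivative_works L_def)
  have "((\<lambda>z. z * a) has_derivative (\<lambda>v. v * a)) (at z)"
    by (auto intro!: derivative_eq_intros)
  from has_derivative_compose[OF this L]
  have "wirt (\<lambda>z. H (z * a)) z = (L (1 * a) - \<i> * L (\<i> * a)) / 2"
    by (rule wirt_eqI)
  also have "\<dots> = a * wirt H (z * a)"
  proof -
    have lin: "L (complex_of_real x + \<i> * complex_of_real y) = complex_of_real x * L 1 + complex_of_real y * L \<i>" for x y
    proof -
      have "L (x *\<^sub>R 1 + y *\<^sub>R \<i>) = x *\<^sub>R L 1 + y *\<^sub>R L \<i>"
        using has_derivative_linear[OF L] by (simp add: linear_add linear_scale)
      then show ?thesis by (simp add: scaleR_conv_of_real mult.commute)
    qed
    have e1: "1 * a = complex_of_real (Re a) + \<i> * complex_of_real (Im a)"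
      unfolding mult_1 by (rule complex_eq)
    have e2: "\<i> * a = complex_of_real (- Im a) + \<i> * complex_of_real (Re a)"
      by (simp add: complex_eq_iff)
    have "L (1 * a) - \<i> * L (\<i> * a) = (complex_of_real (Re a) + \<i> * complex_of_real (Im a)) * (L 1 - \<i> * L \<i>)"
      unfolding e1 e2 lin by (simp add: algebra_simps)
    also have "complex_of_real (Re a) + \<i> * complex_of_real (Im a) = a"
      by (rule complex_eq[symmetric])
    finally show ?thesis by (simp add: wirt_def L_def)
  qed
  finally have "a * wirt H (z * a) = wirt (\<lambda>z. H (z * a)) z" by simp
  also have "\<dots> = wirt (\<lambda>z. cis (k * C) * H z) z"
    unfolding wirt_def
    by (subst (1 2) frechet_derivative_cong_on_open[OF U(1) _ z, of _ "\<lambda>z. cis (k * C) * H z"])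
       (use H in \<open>auto simp: equivariant_def a_def\<close>)
  also have "\<dots> = cis (k * C) * wirt H z"
    by (rule wirt_cmult[OF d[OF z]])
  finally have "cis (- C) * a * wirt H (z * a) = cis (- C) * cis (k * C) * wirt H z"
    by (simp only: mult.assoc)
  moreover have "cis (- C) * a = 1" "cis (- C) * cis (k * C) = cis ((k - 1) * C)"
    by (simp_all add: a_def cis_mult algebra_simps)
  ultimately show "wirt H (z * cis C) = cis ((k - 1) * C) * wirt H z"
    by (simp only: a_def mult_1)
qed

text \<open>
  The derivative along the circle is determined by the weight, so the Wirtinger derivative at
  a real point involves only the radial derivative.
\<close>

lemma wirt_on_real_axis:
  assumes H: "equivariant k H U" and R: "complex_of_real R \<in> U" "R \<noteq> 0"
    and d: "H differentiable (at (complex_of_real R))"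
  shows "wirt H (complex_of_real R) =
    (frechet_derivative H (at (complex_of_real R)) 1 + of_real k * H (complex_of_real R) / of_real R) / 2"
proof -
  define L where "L = frechet_derivative H (at (complex_of_real R))"
  have L: "(H has_derivative L) (at (complex_of_real R))"
    using d by (simp add: frechet_derivative_works L_def)
  have c: "((\<lambda>\<theta>. cis (c * \<theta>)) has_derivative (\<lambda>h. h *\<^sub>R (\<i> * complex_of_real c))) (at 0)" for c
  proof -
    have g: "((\<lambda>\<theta>. \<i> * complex_of_real (c * \<theta>)) has_derivative (\<lambda>h. \<i> * complex_of_real (c * h))) (at 0)"
      by (intro has_derivative_mult_right has_derivative_of_real has_derivative_ident)
    have "(exp has_derivative (*) (exp (\<i> * complex_of_real (c * 0)))) (at (\<i> * complex_of_real (c * 0)))"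
      using DERIV_exp by (simp only: has_field_derivative_def)
    from has_derivative_compose[OF g this] show ?thesis
      by (simp add: cis_conv_exp scaleR_conv_of_real mult_ac)
  qed
  have "((\<lambda>\<theta>. complex_of_real R * cis (1 * \<theta>)) has_derivative (\<lambda>h. complex_of_real R * (h *\<^sub>R (\<i> * complex_of_real 1)))) (at 0)"
    by (rule has_derivative_mult_right[OF c])
  from has_derivative_compose[OF this, of H L] L
  have 1: "((\<lambda>\<theta>. H (complex_of_real R * cis \<theta>)) has_derivative (\<lambda>h. L (complex_of_real R * (h *\<^sub>R \<i>)))) (at 0)"
    by simp
  have 2: "((\<lambda>\<theta>. cis (k * \<theta>) * H (complex_of_real R)) has_derivative (\<lambda>h. h *\<^sub>R (\<i> * complex_of_real k) * H (complex_of_real R))) (at 0)"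
    by (rule has_derivative_mult_left[OF c])
  have "(\<lambda>\<theta>. H (complex_of_real R * cis \<theta>)) = (\<lambda>\<theta>. cis (k * \<theta>) * H (complex_of_real R))"
    using H R by (simp add: equivariant_def)
  with has_derivative_unique[OF 1] 2
  have "(\<lambda>h. L (complex_of_real R * (h *\<^sub>R \<i>))) = (\<lambda>h. h *\<^sub>R (\<i> * complex_of_real k) * H (complex_of_real R))"
    by simp
  from fun_cong[OF this, of 1]
  have "L (R *\<^sub>R \<i>) = \<i> * complex_of_real k * H (complex_of_real R)"
    by (simp add: scaleR_conv_of_real)
  moreover have "L (R *\<^sub>R \<i>) = R *\<^sub>R L \<i>"
    using has_derivative_linear[OF L] by (rule linear_scale)
  ultimately have "L \<i> = \<i> * complex_of_real k * H (complex_of_real R) / complex_of_real R"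
    using R(2) by (simp add: scaleR_conv_of_real field_simps)
  then show ?thesis
    unfolding wirt_def L_def[symmetric] by (simp add: field_simps)
qed

lemma has_vector_derivative_on_real_axis:
  assumes "H differentiable (at (complex_of_real t))"
  shows "((\<lambda>t. H (complex_of_real t)) has_vector_derivative frechet_derivative H (at (complex_of_real t)) 1) (at t)"
  using has_vector_derivative_along_line[of H _ 0 t 1] assms
  by (simp add: frechet_derivative_works scaleR_conv_of_real)

lemma has_real_derivative_on_real_axis:
  assumes "H differentiable (at (complex_of_real t))"
  shows "((\<lambda>t. Re (H (complex_of_real t))) has_real_derivative Re (frechet_derivative H (at (complex_of_real t)) 1)) (at t)"
    and "((\<lambda>t. Im (H (complex_of_real t))) has_real_derivative Im (frechet_derivative H (at (complex_of_real t)) 1)) (at t)"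
  using bounded_linear.has_vector_derivative[OF bounded_linear_Re has_vector_derivative_on_real_axis[OF assms]]
    bounded_linear.has_vector_derivative[OF bounded_linear_Im has_vector_derivative_on_real_axis[OF assms]]
  by (simp_all add: has_real_derivative_iff_has_vector_derivative)

definition radii :: "complex set \<Rightarrow> real set" where
  "radii U = {t. t > 0 \<and> complex_of_real t \<in> U}"

lemma open_radii:
  assumes "open U"
  shows "open (radii U)"
proof -
  have "radii U = {0<..} \<inter> complex_of_real -` U" by (auto simp: radii_def)
  moreover have "open (complex_of_real -` U)"
    by (rule open_vimage[OF assms]) (intro continuous_intros)
  ultimately show ?thesis by auto
qed

lemma rotate_to_real_axis: "z = complex_of_real (cmod z) * cis (Arg z)"
  using rcis_cmod_Arg[of z] by (simp add: rcis_def)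

lemma rotate_mem_iff:
  assumes "rotation_invariant U"
  shows "complex_of_real R * cis \<theta> \<in> U \<longleftrightarrow> complex_of_real R \<in> U"
proof -
  have "(complex_of_real R * cis \<theta>) * cis (- \<theta>) = complex_of_real R"
    by (simp add: mult.assoc cis_mult)
  then show ?thesis
    using assms unfolding rotation_invariant_def by metis
qed

lemma is_interval_radii:
  assumes "connected U" "rotation_invariant U"
  shows "is_interval (radii U)"
proof -
  have "radii U = cmod ` U \<inter> {0<..}"
  proof (intro equalityI subsetI)
    fix t assume "t \<in> radii U"
    then show "t \<in> cmod ` U \<inter> {0<..}"
      by (auto simp: radii_def image_iff intro!: bexI[of _ "complex_of_real t"])
  next
    fix t assume "t \<in> cmod ` U \<inter> {0<..}"
    then obtain z where z: "z \<in> U" "t = cmod z" "t > 0" by auto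
    then have "complex_of_real t * cis (Arg z) \<in> U"
      using rotate_to_real_axis[of z] by simp
    then show "t \<in> radii U"
      using z(3) rotate_mem_iff[OF assms(2)] by (simp add: radii_def)
  qed
  moreover have "is_interval (cmod ` U)"
    using assms(1) by (simp add: is_interval_connected_1 connected_continuous_image continuous_on_norm)
  ultimately show ?thesis
    by (simp add: is_interval_Int)
qed

section \<open>Reduction to the positive real axis\<close>

lemma conformal_factor_has_derivative:
  fixes t :: real
  shows "((\<lambda>t. 4 / (1 + t\<^sup>2)\<^sup>2) has_real_derivative - 16 * t / (1 + t\<^sup>2) ^ 3) (at t)"
proof -
  have "1 + t\<^sup>2 \<noteq> 0" using one_plus_norm_sq_pos[of "complex_of_real t"] by simp
  then show ?thesis
    by (auto intro!: derivative_eq_intros simp: divide_simps power2_eq_square power3_eq_cube)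
qed

definition radial_derivative :: "(complex \<Rightarrow> complex) \<Rightarrow> real \<Rightarrow> complex" where
  "radial_derivative F t = frechet_derivative F (at (complex_of_real t)) 1"

text \<open>
  Up to constant factors, the twist momentum \<open>m\<close> is conjugate to \<open>S = (q / (1 + t\<^sup>2))\<^sup>2\<close> and the
  shear momentum \<open>N\<close> to \<open>P = p / t\<close>.
\<close>

definition twist_momentum :: "(complex \<Rightarrow> complex) \<Rightarrow> real \<Rightarrow> real" where
  "twist_momentum F t = (1 - t\<^sup>2) / (1 + t\<^sup>2) * inv_sqrt_disc F (complex_of_real t)"

definition shear_momentum :: "(complex \<Rightarrow> complex) \<Rightarrow> real \<Rightarrow> real" where
  "shear_momentum F t = t\<^sup>2 * (4 / (1 + t\<^sup>2)\<^sup>2) * inv_sqrt_disc F (complex_of_real t) *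
     (Re (radial_derivative F t) - Re (F (complex_of_real t)) / t)"

context
  fixes F :: "complex \<Rightarrow> complex" and U :: "complex set"
  assumes U: "open U" "rotation_invariant U" and F: "Ck_on 2 F U"
    and nondeg: "nondegenerate_graph F U" and eqF: "equivariant 1 F U"
begin

lemma F_differentiable: "z \<in> U \<Longrightarrow> F differentiable (at z)"
  using Ck_on_2D(2)[OF F] by simp

lemma equivariant_shear: "equivariant (- 2) (shear F) U"
proof -
  have "equivariant (- 1 - 1) (wirt (\<lambda>z. cnj (F z))) U"
    by (rule equivariant_wirt[OF U equivariant_cnj[OF eqF] differentiable_cnj[OF F_differentiable]])
  note eq = equivariantD[OF this]
  have "shear F (z * cis C) = cis (- 2 * C) * shear F z" if "z \<in> U" for z C
    unfolding shear_def eq[OF that] by simp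
  then show ?thesis
    unfolding equivariant_def by blast
qed

lemma equivariant_twist: "equivariant 0 (\<lambda>z. complex_of_real (twist F z)) U"
proof -
  have "equivariant (1 + 0 - 1) (wirt (\<lambda>z. F z * complex_of_real (e2u z))) U"
    by (rule equivariant_wirt[OF U equivariant_mult[OF eqF equivariant_e2u]
            differentiable_mult[OF F_differentiable e2u_differentiable]])
  note eq = equivariantD[OF this]
  have "complex_of_real (twist F (z * cis C)) = cis (0 * C) * complex_of_real (twist F z)" if "z \<in> U" for z C
    unfolding twist_def rho_def e2u_rotate eq[OF that] by simp
  then show ?thesis
    unfolding equivariant_def by blast
qed

lemma equivariant_inv_sqrt_disc: "equivariant 0 (\<lambda>z. complex_of_real (inv_sqrt_disc F z)) U"
proof -
  have "disc F (z * cis C) = disc F z" if "z \<in> U" for z C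
  proof -
    have "twist F (z * cis C) = twist F z"
      using equivariantD[OF equivariant_twist that, of C] by simp
    moreover have "cmod (shear F (z * cis C)) = cmod (shear F z)"
      by (simp only: equivariantD[OF equivariant_shear that] norm_mult norm_cis mult_1)
    ultimately show ?thesis by (simp only: disc_def)
  qed
  then show ?thesis by (simp add: equivariant_def inv_sqrt_disc_def)
qed

lemma equivariant_twist_flux: "equivariant 0 (twist_flux F) U"
  using equivariant_mult[OF equivariant_inv_sqrt_disc equivariant_twist]
  by (simp add: twist_flux_def[abs_def])

lemma equivariant_shear_flux: "equivariant 2 (shear_flux F) U"
  using equivariant_mult[OF equivariant_mult[OF equivariant_e2u equivariant_inv_sqrt_disc] equivariant_cnj[OF equivariant_shear]]
  by (simp add: shear_flux_def[abs_def])

lemma twist_flux_differentiable: "z \<in> U \<Longrightarrow> twist_flux F differentiable (at z)"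
  and shear_flux_differentiable: "z \<in> U \<Longrightarrow> shear_flux F differentiable (at z)"
  and inv_sqrt_disc_differentiable: "z \<in> U \<Longrightarrow> (\<lambda>z. complex_of_real (inv_sqrt_disc F z)) differentiable (at z)"
  using Ck_on_twist_flux[OF U(1) F nondeg] Ck_on_shear_flux[OF U(1) F nondeg] Ck_on_inv_sqrt_disc[OF U(1) F nondeg]
  by simp_all

lemma equivariant_euler_lagrange: "equivariant (- 1) (euler_lagrange F) U"
proof -
  have "equivariant (2 - 1) (wirt (shear_flux F)) U"
    by (rule equivariant_wirt[OF U equivariant_shear_flux shear_flux_differentiable])
  moreover have "equivariant (0 - 1) (wirt (twist_flux F)) U"
    by (rule equivariant_wirt[OF U equivariant_twist_flux twist_flux_differentiable])
  ultimately show ?thesis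
    unfolding equivariant_def euler_lagrange_def e2u_rotate by (simp add: cis_cnj algebra_simps)
qed

text \<open>
  The twist differs from the imaginary part of the shear by the term with \<open>q\<close> alone; its
  coefficient vanishes at \<open>t = 1\<close>, which is why the equator is singular for the radial
  equations.
\<close>

lemma radial_invariants:
  assumes t: "t \<in> radii U"
  defines "p \<equiv> Re (F (complex_of_real t))" and "q \<equiv> Im (F (complex_of_real t))"
    and "p' \<equiv> Re (radial_derivative F t)" and "q' \<equiv> Im (radial_derivative F t)"
  shows "Re (shear F (complex_of_real t)) = - (p' - p / t) / 2"
    and "Im (shear F (complex_of_real t)) = (q' - q / t) / 2"
    and "twist F (complex_of_real t) = (q' - q / t) / 2 + (1 - t\<^sup>2) / (t * (1 + t\<^sup>2)) * q"
proof -
  have t0: "t \<noteq> 0" and tU: "complex_of_real t \<in> U" using t by (auto simp: radii_def)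
  have dF: "(F has_derivative frechet_derivative F (at (complex_of_real t))) (at (complex_of_real t))"
    using F_differentiable[OF tU] by (simp add: frechet_derivative_works)
  have sh: "shear F (complex_of_real t) = - ((cnj (radial_derivative F t) - cnj (F (complex_of_real t)) / complex_of_real t) / 2)"
    unfolding shear_def
    by (subst wirt_on_real_axis[OF equivariant_cnj[OF eqF] tU t0 differentiable_cnj[OF F_differentiable[OF tU]]])
       (simp add: radial_derivative_def flip: frechet_derivative_at[OF has_derivative_cnj[OF dF]])
  show "Re (shear F (complex_of_real t)) = - (p' - p / t) / 2"
    "Im (shear F (complex_of_real t)) = (q' - q / t) / 2"
    unfolding sh p_def q_def p'_def q'_def using t0 by (simp_all add: field_simps)
  let ?E = "\<lambda>z. complex_of_real (e2u z)"
  have dE: "(?E has_derivative frechet_derivative ?E (at (complex_of_real t))) (at (complex_of_real t))"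
    using e2u_differentiable by (simp add: frechet_derivative_works)
  have E1: "frechet_derivative ?E (at (complex_of_real t)) 1 = complex_of_real (- 16 * t / (1 + t\<^sup>2) ^ 3)"
  proof -
    have "((\<lambda>t. complex_of_real (4 / (1 + t\<^sup>2)\<^sup>2)) has_vector_derivative complex_of_real (- 16 * t / (1 + t\<^sup>2) ^ 3)) (at t)"
      using conformal_factor_has_derivative unfolding has_real_derivative_iff_has_vector_derivative
      by (rule bounded_linear.has_vector_derivative[OF bounded_linear_of_real])
    moreover have "(\<lambda>t. complex_of_real (4 / (1 + t\<^sup>2)\<^sup>2)) = (\<lambda>t. ?E (complex_of_real t))"
      by (simp add: e2u_def)
    ultimately have "((\<lambda>t. ?E (complex_of_real t)) has_vector_derivative complex_of_real (- 16 * t / (1 + t\<^sup>2) ^ 3)) (at t)"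
      by (simp only:)
    then show ?thesis
      by (rule vector_derivative_unique_at[OF has_vector_derivative_on_real_axis[OF e2u_differentiable]])
  qed
  have Et: "?E (complex_of_real t) = complex_of_real (4 / (1 + t\<^sup>2)\<^sup>2)"
    by (simp add: e2u_def)
  have wF: "wirt (\<lambda>z. F z * ?E z) (complex_of_real t) =
     (F (complex_of_real t) * frechet_derivative ?E (at (complex_of_real t)) 1 + radial_derivative F t * ?E (complex_of_real t)
        + F (complex_of_real t) * ?E (complex_of_real t) / complex_of_real t) / 2"
    by (subst wirt_on_real_axis[OF equivariant_mult[OF eqF equivariant_e2u] tU t0 differentiable_mult[OF F_differentiable[OF tU] e2u_differentiable]])
       (simp add: radial_derivative_def flip: frechet_derivative_at[OF has_derivative_mult[OF dF dE]])
  have "Im (wirt (\<lambda>z. F z * ?E z) (complex_of_real t)) =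
     (q * (- 16 * t / (1 + t\<^sup>2) ^ 3) + q' * (4 / (1 + t\<^sup>2)\<^sup>2) + q * (4 / (1 + t\<^sup>2)\<^sup>2) / t) / 2"
    unfolding wF E1 Et q_def q'_def
    by (simp del: of_real_divide of_real_mult of_real_power of_real_add of_real_minus)
  also have "\<dots> = ((q' - q / t) / 2 + (1 - t\<^sup>2) / (t * (1 + t\<^sup>2)) * q) * (4 / (1 + t\<^sup>2)\<^sup>2)"
  proof -
    define S where "S = 1 + t\<^sup>2"
    have S0: "S \<noteq> 0" using one_plus_norm_sq_pos[of "complex_of_real t"] by (simp add: S_def)
    have k: "(1 - t\<^sup>2) / (t * S) = 1 / t - 2 * t / S"
      using t0 S0 by (simp add: divide_simps) (simp add: S_def power2_eq_square algebra_simps)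
    define c where "c = 4 / S\<^sup>2"
    have c: "- 16 * t / S ^ 3 = - 4 * t / S * c"
      by (simp add: c_def power2_eq_square power3_eq_cube mult.assoc)
    show ?thesis
      unfolding S_def[symmetric] k c c_def[symmetric] using t0 S0 by (simp add: field_simps)
  qed
  finally have "twist F (complex_of_real t) * (4 / (1 + t\<^sup>2)\<^sup>2) =
      ((q' - q / t) / 2 + (1 - t\<^sup>2) / (t * (1 + t\<^sup>2)) * q) * (4 / (1 + t\<^sup>2)\<^sup>2)"
    using twist_mult_e2u[of F "complex_of_real t"] by (simp add: e2u_def)
  moreover have "4 / (1 + t\<^sup>2)\<^sup>2 \<noteq> 0"
    using one_plus_norm_sq_pos[of "complex_of_real t"] by simp
  ultimately show "twist F (complex_of_real t) = (q' - q / t) / 2 + (1 - t\<^sup>2) / (t * (1 + t\<^sup>2)) * q"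
    by (simp only: mult_cancel_right simp_thms)
qed

lemma disc_radial:
  assumes t: "t \<in> radii U"
  shows "disc F (complex_of_real t) =
    (1 - t\<^sup>2) / (t * (1 + t\<^sup>2)) * Im (F (complex_of_real t)) *
       (Im (radial_derivative F t) - 2 * t * Im (F (complex_of_real t)) / (1 + t\<^sup>2))
    - (Re (radial_derivative F t) - Re (F (complex_of_real t)) / t)\<^sup>2 / 4"
proof -
  have t0: "t \<noteq> 0" using t by (auto simp: radii_def)
  have t1: "1 + t\<^sup>2 \<noteq> 0" using one_plus_norm_sq_pos[of "complex_of_real t"] by simp
  define k q s where "k = (1 - t\<^sup>2) / (t * (1 + t\<^sup>2))" and "q = Im (F (complex_of_real t))"
    and "s = (Im (radial_derivative F t) - q / t) / 2"
  have "disc F (complex_of_real t) = (s + k * q)\<^sup>2 - s\<^sup>2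
      - (Re (radial_derivative F t) - Re (F (complex_of_real t)) / t)\<^sup>2 / 4"
    unfolding disc_def cmod_power2 radial_invariants[OF t]
    by (simp add: k_def q_def s_def power_divide power2_commute)
  also have "(s + k * q)\<^sup>2 - s\<^sup>2 = k * q * (2 * s + k * q)"
    by (simp add: power2_eq_square algebra_simps)
  also have "2 * s + k * q = Im (radial_derivative F t) - 2 * t * q / (1 + t\<^sup>2)"
    using t0 t1 unfolding s_def k_def by (simp add: divide_simps) (simp add: power2_eq_square algebra_simps)
  finally show ?thesis by (simp add: k_def q_def)
qed

lemma inv_sqrt_disc_radial_derivative:
  assumes t: "t \<in> radii U"
  shows "((\<lambda>t. inv_sqrt_disc F (complex_of_real t)) has_real_derivative
    Re (frechet_derivative (\<lambda>z. complex_of_real (inv_sqrt_disc F z)) (at (complex_of_real t)) 1)) (at t)"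
  using has_real_derivative_on_real_axis(1)[OF inv_sqrt_disc_differentiable] t by (simp add: radii_def)

text \<open>
  Continuity of the derivative will show that the set where it does not vanish is open.
\<close>

lemma twist_momentum_C1:
  obtains m' where "continuous_on (radii U) m'"
    and "\<And>t. t \<in> radii U \<Longrightarrow> (twist_momentum F has_real_derivative m' t) (at t)"
proof -
  let ?D = "\<lambda>t. Re (frechet_derivative (\<lambda>z. complex_of_real (inv_sqrt_disc F z)) (at (complex_of_real t)) 1)"
  define m' where "m' t = (1 - t\<^sup>2) / (1 + t\<^sup>2) * ?D t - 4 * t / (1 + t\<^sup>2)\<^sup>2 * inv_sqrt_disc F (complex_of_real t)" for t
  have t1: "1 + t\<^sup>2 \<noteq> 0" for t :: real using one_plus_norm_sq_pos[of "complex_of_real t"] by simp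
  have img: "complex_of_real ` radii U \<subseteq> U" by (auto simp: radii_def)
  have "continuous_on U (\<lambda>z. frechet_derivative (\<lambda>z. complex_of_real (inv_sqrt_disc F z)) (at z) 1)"
    using Ck_on_inv_sqrt_disc[OF U(1) F nondeg] by simp
  then have "continuous_on (radii U) (\<lambda>t. frechet_derivative (\<lambda>z. complex_of_real (inv_sqrt_disc F z)) (at (complex_of_real t)) 1)"
    by (rule continuous_on_compose2) (use img in \<open>auto intro: continuous_intros\<close>)
  then have cD: "continuous_on (radii U) ?D"
    by (rule continuous_on_Re)
  have cw: "continuous_on (radii U) (\<lambda>t. inv_sqrt_disc F (complex_of_real t))"
    using DERIV_isCont[OF inv_sqrt_disc_radial_derivative] by (intro continuous_at_imp_continuous_on) auto
  have "continuous_on (radii U) m'"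
    unfolding m'_def by (intro continuous_intros cD cw) (use t1 in auto)
  moreover have "(twist_momentum F has_real_derivative m' t) (at t)" if "t \<in> radii U" for t
  proof -
    have "((\<lambda>t. (1 - t\<^sup>2) / (1 + t\<^sup>2)) has_real_derivative - 4 * t / (1 + t\<^sup>2)\<^sup>2) (at t)"
      using t1[of t] by (auto intro!: derivative_eq_intros simp: divide_simps) (simp add: power2_eq_square algebra_simps)
    from DERIV_mult[OF this inv_sqrt_disc_radial_derivative[OF that]]
    show ?thesis
      unfolding twist_momentum_def m'_def by (simp add: algebra_simps)
  qed
  ultimately show ?thesis using that by blast
qed

text \<open>
  On the axis the real and the imaginary part of the shear flux are
  \<open>- N / (2 t\<^sup>2)\<close> and \<open>- e\<^bsup>2u\<^esup> (w \<lambda> - m q / t)\<close>. In this form no second derivative of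
  \<open>q\<close> is needed: the derivative of \<open>w \<lambda>\<close> cancels against the one in the Euler-Lagrange
  equation, and of the remaining terms only the one with \<open>m'\<close> survives.
\<close>

lemma radial_euler_lagrange:
  assumes R: "R \<in> radii U" and m': "(twist_momentum F has_real_derivative m') (at R)"
  shows "euler_lagrange F (complex_of_real R) = 0 \<longleftrightarrow>
    (shear_momentum F has_real_derivative 0) (at R) \<and> m' * Im (F (complex_of_real R)) = 0"
    and "\<exists>n'. (shear_momentum F has_real_derivative n') (at R)"
proof -
  have o: "open (radii U)" by (rule open_radii[OF U(1)])
  have R0: "R \<noteq> 0" and RU: "complex_of_real R \<in> U" using R by (auto simp: radii_def)
  define e where "e t = 4 / (1 + t\<^sup>2)\<^sup>2" for t :: real
  have t1: "1 + t\<^sup>2 \<noteq> 0" for t :: real using one_plus_norm_sq_pos[of "complex_of_real t"] by simp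
  have e0: "e R \<noteq> 0" using t1[of R] by (simp add: e_def)
  define de where "de = - 4 * R / (1 + R\<^sup>2) * e R"
  have e': "(e has_real_derivative de) (at R)"
    unfolding de_def using conformal_factor_has_derivative[of R]
    by (simp add: e_def[abs_def] power2_eq_square power3_eq_cube mult.assoc)
  define Z' where "Z' = frechet_derivative (shear_flux F) (at (complex_of_real R)) 1"
  define Y' where "Y' = frechet_derivative (twist_flux F) (at (complex_of_real R)) 1"
  let ?Z = "\<lambda>t. shear_flux F (complex_of_real t)" and ?Y = "\<lambda>t. twist_flux F (complex_of_real t)"
  let ?q = "\<lambda>t. Im (F (complex_of_real t))"
  define q' where "q' = Im (radial_derivative F R)"
  note dZ = has_real_derivative_on_real_axis[OF shear_flux_differentiable[OF RU], folded Z'_def]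
  note dY = has_real_derivative_on_real_axis[OF twist_flux_differentiable[OF RU], folded Y'_def]
  have dq: "(?q has_real_derivative q') (at R)"
    using has_real_derivative_on_real_axis(2)[OF F_differentiable[OF RU]] by (simp add: q'_def radial_derivative_def)
  have ZN: "- 2 * t\<^sup>2 * Re (?Z t) = shear_momentum F t" if t: "t \<in> radii U" for t
    using t unfolding shear_flux_def shear_momentum_def
    by (simp add: radial_invariants(1)[OF t] e2u_def) (simp add: algebra_simps diff_divide_distrib)
  have Zi: "Im (?Z t) = - e t * (inv_sqrt_disc F (complex_of_real t) * ((Im (radial_derivative F t) - ?q t / t) / 2))" if t: "t \<in> radii U" for t
    unfolding shear_flux_def by (simp add: radial_invariants(2)[OF t] e2u_def e_def)
  have Yr: "Re (?Y t) = inv_sqrt_disc F (complex_of_real t) * ((Im (radial_derivative F t) - ?q t / t) / 2)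
      + twist_momentum F t * ?q t / t" if t: "t \<in> radii U" for t
    unfolding twist_flux_def twist_momentum_def
    by (simp add: radial_invariants(3)[OF t]) (simp add: algebra_simps)
  have Y'im: "Im Y' = 0"
  proof -
    have "((\<lambda>t. Im (?Y t)) has_real_derivative 0) (at R)"
      by (simp add: twist_flux_def)
    with dY(2) show ?thesis by (rule DERIV_unique)
  qed
  have dN: "(shear_momentum F has_real_derivative - 2 * R\<^sup>2 * (Re Z' + 2 * Re (?Z R) / R)) (at R)"
  proof -
    define x where "x t = Re (?Z t)" for t
    have dx: "(x has_real_derivative Re Z') (at R)" using dZ(1) by (simp add: x_def[abs_def])
    have "((\<lambda>t. - 2 * t\<^sup>2 * x t) has_real_derivative - 2 * R\<^sup>2 * (Re Z' + 2 * x R / R)) (at R)"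
      using R0 by (auto intro!: derivative_eq_intros dx simp: field_simps power2_eq_square)
    then show ?thesis
      unfolding x_def by (rule has_field_derivative_transform_within_open[OF _ o R ZN])
  qed
  then show "\<exists>n'. (shear_momentum F has_real_derivative n') (at R)" by blast
  \<comment> \<open>The imaginary part of the equation, where the weight 2 of the shear flux enters.\<close>
  have Zim: "Im Z' + 2 * Im (?Z R) / R + e R * Re Y' = e R * m' * ?q R / R"
  proof -
    have Zie: "Im (?Z t) = - e t * (Re (?Y t) - twist_momentum F t * ?q t / t)" if "t \<in> radii U" for t
      using Zi[OF that] Yr[OF that] by simp
    define f where "f t = ?q t" for t
    define g where "g t = Re (?Y t)" for t
    define M Q y where "M = twist_momentum F R" and "Q = f R" and "y = g R"
    have df: "(f has_real_derivative q') (at R)" and dg: "(g has_real_derivative Re Y') (at R)"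
      using dq dY(1) by (simp_all add: f_def[abs_def] g_def[abs_def])
    have "((\<lambda>t. - e t * (g t - twist_momentum F t * f t / t)) has_real_derivative
        - de * (y - M * Q / R) - e R * (Re Y' - ((m' * Q + M * q') * R - M * Q) / R\<^sup>2)) (at R)"
      using R0 unfolding M_def Q_def y_def
      by (auto intro!: derivative_eq_intros e' dg m' df simp: power2_eq_square algebra_simps)
        (simp add: add_divide_distrib diff_divide_distrib)
    then have "((\<lambda>t. Im (?Z t)) has_real_derivative
        - de * (y - M * Q / R) - e R * (Re Y' - ((m' * Q + M * q') * R - M * Q) / R\<^sup>2)) (at R)"
      by (rule has_field_derivative_transform_within_open[OF _ o R]) (use Zie in \<open>simp add: f_def g_def\<close>)
    then have Z'i: "Im Z' = - de * (y - M * Q / R) - e R * (Re Y' - ((m' * Q + M * q') * R - M * Q) / R\<^sup>2)"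
      by (rule DERIV_unique[OF dZ(2)])
    define w s where "w = inv_sqrt_disc F (complex_of_real R)" and "s = (q' - Q / R) / 2"
    have yM: "y - M * Q / R = w * s"
      using Yr[OF R] by (simp add: y_def M_def Q_def w_def s_def q'_def f_def g_def)
    have ZR: "Im (?Z R) = - e R * (w * s)"
      using Zi[OF R] by (simp add: w_def s_def q'_def Q_def f_def)
    have q's: "q' = 2 * s + Q / R" using R0 by (simp add: s_def field_simps)
    have Mw: "M = (1 - R\<^sup>2) / (1 + R\<^sup>2) * w" by (simp add: M_def w_def twist_momentum_def)
    have "Im Z' + 2 * Im (?Z R) / R + e R * Re Y' =
       e R * (4 * R / (1 + R\<^sup>2) * (w * s) + m' * Q / R + 2 * M * s / R - 2 * (w * s) / R)"
      unfolding Z'i yM ZR q's de_def using R0 by (simp add: power2_eq_square field_simps)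
    also have "4 * R / (1 + R\<^sup>2) * (w * s) + m' * Q / R + 2 * M * s / R - 2 * (w * s) / R = m' * Q / R"
      unfolding Mw using R0 t1[of R] by (simp add: divide_simps) (simp add: power2_eq_square algebra_simps)
    finally show ?thesis by (simp add: Q_def f_def)
  qed
  have wZ: "wirt (shear_flux F) (complex_of_real R) = (Z' + 2 * ?Z R / R) / 2"
    unfolding Z'_def
    by (subst wirt_on_real_axis[OF equivariant_shear_flux RU R0 shear_flux_differentiable[OF RU]]) simp
  have wY: "wirt (twist_flux F) (complex_of_real R) = Y' / 2"
    unfolding Y'_def
    by (subst wirt_on_real_axis[OF equivariant_twist_flux RU R0 twist_flux_differentiable[OF RU]]) simp
  have eR: "e2u (complex_of_real R) = e R" by (simp add: e2u_def e_def)
  have re: "Re (euler_lagrange F (complex_of_real R)) = (Re Z' + 2 * Re (?Z R) / R) / 2"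
    unfolding euler_lagrange_def wZ wY eR by (simp add: Y'im)
  have im: "Im (euler_lagrange F (complex_of_real R)) = - (Im Z' + 2 * Im (?Z R) / R + e R * Re Y') / 2"
    unfolding euler_lagrange_def wZ wY eR by (simp add: field_simps)
  have "euler_lagrange F (complex_of_real R) = 0 \<longleftrightarrow>
      Re Z' + 2 * Re (?Z R) / R = 0 \<and> e R * m' * ?q R / R = 0"
    unfolding complex_eq_iff re im Zim by simp
  also have "Re Z' + 2 * Re (?Z R) / R = 0 \<longleftrightarrow> (shear_momentum F has_real_derivative 0) (at R)"
    using dN R0 DERIV_unique[OF dN, of 0] by auto
  also have "e R * m' * ?q R / R = 0 \<longleftrightarrow> m' * ?q R = 0"
    using e0 R0 by simp
  finally show "euler_lagrange F (complex_of_real R) = 0 \<longleftrightarrow>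
    (shear_momentum F has_real_derivative 0) (at R) \<and> m' * Im (F (complex_of_real R)) = 0" .
qed

text \<open>
  Equivariance moves the equation from the axis to every nonzero point; the origin is a limit
  of such points.
\<close>

lemma euler_lagrange_iff_radial:
  "(\<forall>z\<in>U. euler_lagrange F z = 0) \<longleftrightarrow> (\<forall>t\<in>radii U. euler_lagrange F (complex_of_real t) = 0)"
proof
  assume *: "\<forall>t\<in>radii U. euler_lagrange F (complex_of_real t) = 0"
  have nz: "euler_lagrange F z = 0" if z: "z \<in> U" "z \<noteq> 0" for z
  proof -
    have "complex_of_real (cmod z) = z * cis (- Arg z)"
      using arg_cong[OF rotate_to_real_axis[of z], of "\<lambda>x. x * cis (- Arg z)"]
      by (simp add: mult.assoc cis_mult)
    then have r: "cmod z \<in> radii U"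
      using U(2) z by (auto simp: rotation_invariant_def radii_def)
    then have "complex_of_real (cmod z) \<in> U" by (simp add: radii_def)
    from equivariantD[OF equivariant_euler_lagrange this, of "Arg z"]
    show ?thesis using * r rotate_to_real_axis[of z] by simp
  qed
  show "\<forall>z\<in>U. euler_lagrange F z = 0"
  proof
    fix z assume z: "z \<in> U"
    show "euler_lagrange F z = 0"
    proof (cases "z = 0")
      case True
      have "continuous (at z) (euler_lagrange F)"
        using continuous_on_euler_lagrange[OF U(1) F nondeg] U(1) z by (simp add: continuous_on_eq_continuous_at)
      then have "(euler_lagrange F \<longlongrightarrow> euler_lagrange F z) (at z)"
        by (simp add: continuous_at)
      moreover have "\<forall>\<^sub>F x in at z. euler_lagrange F x = 0"
        unfolding eventually_at_topological using U(1) z nz True by blast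
      then have "(euler_lagrange F \<longlongrightarrow> 0) (at z)"
        by (rule tendsto_eventually)
      ultimately show ?thesis
        using tendsto_unique[OF at_neq_bot] by blast
    qed (use nz z in blast)
  qed
qed (simp add: radii_def)

end

section \<open>The radial equations and their solutions\<close>

lemma const_if_derivative_zero_on_interval:
  fixes f :: "real \<Rightarrow> real"
  assumes "is_interval I" "\<And>t. t \<in> I \<Longrightarrow> (f has_real_derivative 0) (at t)"
  obtains c where "\<And>t. t \<in> I \<Longrightarrow> f t = c"
  using has_field_derivative_zero_constant[OF is_interval_convex[OF assms(1)], of f] assms(2)
  by (metis has_field_derivative_at_within)

lemma sgn_const_on_interval:
  fixes f :: "real \<Rightarrow> real"
  assumes I: "is_interval I" and f: "continuous_on I f" and nz: "\<And>t. t \<in> I \<Longrightarrow> f t \<noteq> 0"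
    and st: "s \<in> I" "t \<in> I"
  shows "sgn (f s) = sgn (f t)"
proof -
  have "connected (f ` I)"
    using I f by (simp add: connected_continuous_image is_interval_connected)
  then have int: "is_interval (f ` I)"
    by (simp add: is_interval_connected_1)
  have "\<not> (f x < 0 \<and> 0 < f y)" if "x \<in> I" "y \<in> I" for x y
  proof
    assume "f x < 0 \<and> 0 < f y"
    then have "0 \<in> f ` I"
      using mem_is_interval_1_I[OF int, of "f x" "f y" 0] that by auto
    then show False using nz by force
  qed
  from this[OF st] this[OF st(2,1)] nz[OF st(1)] nz[OF st(2)] show ?thesis
    by (auto simp: sgn_if)
qed

text \<open>
  The function \<open>t / (1 + t\<^sup>2)\<close> takes the same value at two different points only if they are
  reciprocal to each other, and a point has only one reciprocal.
\<close>

lemma radial_ratio_not_constant: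
  fixes J :: "real set"
  assumes J: "open J" "t0 \<in> J" "J \<subseteq> {0<..}"
  obtains t where "t \<in> J" "t / (1 + t\<^sup>2) \<noteq> t0 / (1 + t0\<^sup>2)"
proof -
  obtain d where d: "d > 0" "ball t0 d \<subseteq> J"
    using J open_contains_ball by blast
  have inJ: "t0 + d / 2 \<in> J" "t0 + d / 3 \<in> J"
    using d by (auto simp: subset_iff dist_real_def)
  have eq: "t * t0 = 1" if "t / (1 + t\<^sup>2) = t0 / (1 + t0\<^sup>2)" "t \<noteq> t0" for t
  proof -
    have "1 + t\<^sup>2 \<noteq> 0" "1 + t0\<^sup>2 \<noteq> 0" by (smt (verit) zero_le_power2)+
    then have "(t - t0) * (1 - t * t0) = 0"
      using that(1) by (simp add: field_simps power2_eq_square)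
    then show ?thesis using that(2) by simp
  qed
  have "(t0 + d / 2) * t0 \<noteq> 1 \<or> (t0 + d / 3) * t0 \<noteq> 1"
  proof -
    have "d * t0 > 0" using J d by auto
    then show ?thesis by (auto simp: algebra_simps)
  qed
  then show ?thesis
    using eq[of "t0 + d / 2"] eq[of "t0 + d / 3"] inJ d that by auto
qed

text \<open>
  The value of \<open>\<Delta>\<close> on the real axis; see \<open>disc_radial\<close>.
\<close>

definition radial_disc :: "(real \<Rightarrow> real) \<Rightarrow> (real \<Rightarrow> real) \<Rightarrow> (real \<Rightarrow> real) \<Rightarrow> (real \<Rightarrow> real) \<Rightarrow> real \<Rightarrow> real" where
  "radial_disc p p' q q' t =
    (1 - t\<^sup>2) / (t * (1 + t\<^sup>2)) * q t * (q' t - 2 * t * q t / (1 + t\<^sup>2)) - (p' t - p t / t)\<^sup>2 / 4"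

text \<open>
  Here \<open>p\<close> and \<open>q\<close> stand for the real and the imaginary part of \<open>F\<close> on the positive real
  axis, and \<open>w\<close> for \<open>sgn \<Delta> / |\<Delta>|\<^bsup>1/2\<^esup>\<close>: the remaining problem is about functions of one
  real variable only.
\<close>

locale radial_profile =
  fixes I :: "real set" and p p' q q' w :: "real \<Rightarrow> real"
  assumes I_open: "open I" and I_interval: "is_interval I" and I_pos: "I \<subseteq> {0<..}" and I_nonempty: "I \<noteq> {}"
    and p': "\<And>t. t \<in> I \<Longrightarrow> (p has_real_derivative p' t) (at t)"
    and q': "\<And>t. t \<in> I \<Longrightarrow> (q has_real_derivative q' t) (at t)"
    and nondeg: "\<And>t. t \<in> I \<Longrightarrow> radial_disc p p' q q' t \<noteq> 0"
    and w: "\<And>t. t \<in> I \<Longrightarrow> w t = sgn (radial_disc p p' q q' t) / sqrt \<bar>radial_disc p p' q q' t\<bar>"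
begin

abbreviation "\<Delta> \<equiv> radial_disc p p' q q'"

definition profile_shear_momentum :: "real \<Rightarrow> real" where
  "profile_shear_momentum t = t\<^sup>2 * (4 / (1 + t\<^sup>2)\<^sup>2) * w t * (p' t - p t / t)"

definition profile_twist_momentum :: "real \<Rightarrow> real" where
  "profile_twist_momentum t = (1 - t\<^sup>2) / (1 + t\<^sup>2) * w t"

lemma pos: "t \<in> I \<Longrightarrow> t > 0"
  using I_pos by auto

lemma one_plus_sq: "1 + t\<^sup>2 > (0::real)"
  by (smt (verit) zero_le_power2)

lemma w_nonzero: "t \<in> I \<Longrightarrow> w t \<noteq> 0"
  using w nondeg by (simp add: sgn_if)

lemma w_sq: "t \<in> I \<Longrightarrow> (w t)\<^sup>2 * \<bar>\<Delta> t\<bar> = 1"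
  using w nondeg by (simp add: power_divide sgn_if)

lemma sgn_w: "t \<in> I \<Longrightarrow> sgn (w t) = sgn (\<Delta> t)"
  using w nondeg by (simp add: sgn_if)

definition solution :: "real \<Rightarrow> real \<Rightarrow> real \<Rightarrow> real \<Rightarrow> real \<Rightarrow> bool" where
  "solution A1 A2 B1 B2 \<epsilon> \<longleftrightarrow> (\<forall>t\<in>I.
      (let D = A2 * t\<^sup>2 + B2 * (1 + t\<^sup>2)\<^sup>2 - B1\<^sup>2 * (1 + t\<^sup>2) ^ 4 / t\<^sup>2
       in D \<ge> 0 \<and> p t = A1 * t + B1 * (1 + t\<^sup>2)\<^sup>2 / t \<and> q t = \<epsilon> * sqrt D))"

text \<open>
  Differentiating \<open>q\<^sup>2\<close> instead of \<open>q\<close> avoids the points where the root is not differentiable.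
  All terms with \<open>B\<^sub>1\<close> and \<open>B\<^sub>2\<close> cancel in \<open>\<Delta>\<close>.
\<close>

lemma momenta_constant_if_solution:
  assumes sol: "solution A1 A2 B1 B2 \<epsilon>" and \<epsilon>: "\<epsilon> \<in> {1, - 1}" and A2: "A2 \<noteq> 0"
    and m': "\<And>t. t \<in> I \<Longrightarrow> (profile_twist_momentum has_real_derivative m' t) (at t)" and t: "t \<in> I"
  shows "(profile_shear_momentum has_real_derivative 0) (at t)" and "m' t = 0"
proof -
  define D where "D t = A2 * t\<^sup>2 + B2 * (1 + t\<^sup>2)\<^sup>2 - B1\<^sup>2 * (1 + t\<^sup>2) ^ 4 / t\<^sup>2" for t
  have pt: "p t = A1 * t + B1 * (1 + t\<^sup>2)\<^sup>2 / t" and qt: "(q t)\<^sup>2 = D t" if "t \<in> I" for t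
    using sol that \<epsilon> by (auto simp: solution_def Let_def D_def power_mult_distrib)
  have u: "p' t - p t / t = - 2 * B1 * (1 - t ^ 4) / t\<^sup>2" if t: "t \<in> I" for t
  proof -
    have "((\<lambda>t. A1 * t + B1 * (1 + t\<^sup>2)\<^sup>2 / t) has_real_derivative A1 + B1 * (4 * (1 + t\<^sup>2) - (1 + t\<^sup>2)\<^sup>2 / t\<^sup>2)) (at t)"
      using pos[OF t] by (auto intro!: derivative_eq_intros simp: field_simps power2_eq_square)
    then have "(p has_real_derivative A1 + B1 * (4 * (1 + t\<^sup>2) - (1 + t\<^sup>2)\<^sup>2 / t\<^sup>2)) (at t)"
      by (rule has_field_derivative_transform_within_open[OF _ I_open t]) (simp add: pt)
    from DERIV_unique[OF p'[OF t] this] have "p' t = A1 + B1 * (4 * (1 + t\<^sup>2) - (1 + t\<^sup>2)\<^sup>2 / t\<^sup>2)" .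
    moreover have "p t / t = A1 + B1 * ((1 + t\<^sup>2)\<^sup>2 / t\<^sup>2)"
      using pos[OF t] pt[OF t] by (simp add: add_divide_distrib power2_eq_square)
    ultimately have "p' t - p t / t = B1 * (4 * (1 + t\<^sup>2) - 2 * ((1 + t\<^sup>2)\<^sup>2 / t\<^sup>2))"
      by (simp add: algebra_simps)
    also have "4 * (1 + t\<^sup>2) - 2 * ((1 + t\<^sup>2)\<^sup>2 / t\<^sup>2) = - 2 * (1 - t ^ 4) / t\<^sup>2"
      using pos[OF t] by (simp add: divide_simps) (simp add: power2_eq_square power4_eq_xxxx algebra_simps)
    finally show ?thesis by (simp add: algebra_simps)
  qed
  have qq: "q t * q' t = A2 * t + 2 * B2 * t * (1 + t\<^sup>2) - B1\<^sup>2 * (4 * (1 + t\<^sup>2) ^ 3 / t - (1 + t\<^sup>2) ^ 4 / t ^ 3)" (is "_ = ?r")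
    if t: "t \<in> I" for t
  proof -
    have "(D has_real_derivative 2 * ?r) (at t)"
    proof -
      have d1: "((\<lambda>t. (1 + t\<^sup>2) ^ 4 / t\<^sup>2) has_real_derivative
          2 * (4 * (1 + t\<^sup>2) ^ 3 / t - (1 + t\<^sup>2) ^ 4 / t ^ 3)) (at t)"
        using pos[OF t] by (auto intro!: derivative_eq_intros simp: diff_divide_distrib)
          (simp add: power2_eq_square power3_eq_cube power4_eq_xxxx algebra_simps add_divide_distrib)
      have d2: "((\<lambda>t. A2 * t\<^sup>2 + B2 * (1 + t\<^sup>2)\<^sup>2) has_real_derivative
          2 * (A2 * t + 2 * B2 * t * (1 + t\<^sup>2))) (at t)"
        by (auto intro!: derivative_eq_intros)
      show ?thesis
        using DERIV_diff[OF d2 DERIV_cmult[OF d1, of "B1\<^sup>2"]]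
        by (simp add: D_def[abs_def] algebra_simps)
    qed
    moreover have "(D has_real_derivative 2 * (q t * q' t)) (at t)"
    proof -
      have "((\<lambda>t. (q t)\<^sup>2) has_real_derivative 2 * (q t * q' t)) (at t)"
        using q'[OF t] by (auto intro!: derivative_eq_intros)
      then show ?thesis
        by (rule has_field_derivative_transform_within_open[OF _ I_open t]) (simp add: qt)
    qed
    ultimately show ?thesis using DERIV_unique by fastforce
  qed
  have \<Delta>: "\<Delta> t = A2 * ((1 - t\<^sup>2) / (1 + t\<^sup>2))\<^sup>2" if t: "t \<in> I" for t
  proof -
    define S where "S = 1 + t\<^sup>2"
    have S0: "S \<noteq> 0" and t0: "t \<noteq> 0" using one_plus_sq[of t] pos[OF t] by (auto simp: S_def)
    have tS: "t\<^sup>2 = S - 1" by (simp add: S_def)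
    define k where "k = 1 - t\<^sup>2"
    have k: "k = 2 - S" and t4: "1 - t ^ 4 = k * S"
      by (simp_all add: S_def k_def power2_eq_square power4_eq_xxxx algebra_simps)
    \<comment> \<open>The contributions of \<open>A2\<close>, \<open>B2\<close> and \<open>B1\<close>, in this order.\<close>
    have e1: "t - 2 * t / S * t\<^sup>2 = k * t / S"
      unfolding tS k using S0 by (simp add: field_simps)
    have e2: "2 * t * S - 2 * t / S * S\<^sup>2 = 0"
      using S0 by (simp add: power2_eq_square)
    have e3: "4 * S ^ 3 / t - S ^ 4 / t ^ 3 - 2 * t / S * (S ^ 4 / t\<^sup>2) = - (k * S ^ 3 / t ^ 3)"
    proof -
      define X Y where "X = S ^ 3 / t ^ 3" and "Y = S ^ 3 / t"
      have "Y = X * t\<^sup>2"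
        using t0 by (simp add: X_def Y_def power2_eq_square power3_eq_cube)
      then have Y: "Y = X * (S - 1)"
        by (simp add: tS)
      have "2 * t / S * (S ^ 4 / t\<^sup>2) = 2 * Y"
        using t0 S0 by (simp add: Y_def power2_eq_square power3_eq_cube power4_eq_xxxx)
      moreover have "S ^ 4 / t ^ 3 = S * X"
        by (simp add: X_def power3_eq_cube power4_eq_xxxx)
      moreover have "4 * S ^ 3 / t = 4 * Y" "k * S ^ 3 / t ^ 3 = k * X"
        by (simp_all add: X_def Y_def)
      ultimately show ?thesis
        unfolding k Y by (simp add: algebra_simps)
    qed
    have "q t * (q' t - 2 * t * q t / S) = q t * q' t - 2 * t / S * (q t)\<^sup>2"
      by (simp add: power2_eq_square algebra_simps)
    also have "\<dots> = A2 * (t - 2 * t / S * t\<^sup>2) + B2 * (2 * t * S - 2 * t / S * S\<^sup>2)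
        - B1\<^sup>2 * (4 * S ^ 3 / t - S ^ 4 / t ^ 3 - 2 * t / S * (S ^ 4 / t\<^sup>2))"
      unfolding qq[OF t] qt[OF t] D_def S_def[symmetric] by (simp add: algebra_simps)
    also have "\<dots> = k * (A2 * t / S + B1\<^sup>2 * S ^ 3 / t ^ 3)"
      unfolding e1 e2 e3 by (simp add: algebra_simps)
    finally have "\<Delta> t = k / (t * S) * (k * (A2 * t / S + B1\<^sup>2 * S ^ 3 / t ^ 3)) - (- 2 * B1 * (k * S) / t\<^sup>2)\<^sup>2 / 4"
      unfolding radial_disc_def u[OF t] t4 S_def[symmetric] k_def[symmetric] by (simp only: mult.assoc)
    also have "\<dots> = A2 * (k / S)\<^sup>2"
      using t0 S0 by (simp add: field_simps power2_eq_square power3_eq_cube)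
    finally have "\<Delta> t = A2 * (k / S)\<^sup>2" .
    then show ?thesis by (simp add: S_def k_def)
  qed
  have m2: "(profile_twist_momentum t)\<^sup>2 = 1 / \<bar>A2\<bar>" if t: "t \<in> I" for t
  proof -
    have "(profile_twist_momentum t)\<^sup>2 * \<bar>A2\<bar> = (w t)\<^sup>2 * \<bar>\<Delta> t\<bar>"
      unfolding profile_twist_momentum_def \<Delta>[OF t] by (simp add: abs_mult power_mult_distrib power_divide)
    then show ?thesis using w_sq[OF t] A2 by (simp add: field_simps)
  qed
  have "((\<lambda>t. (profile_twist_momentum t)\<^sup>2) has_real_derivative 2 * (profile_twist_momentum t * m' t)) (at t)"
    using m'[OF t] by (auto intro!: derivative_eq_intros)
  then have "((\<lambda>t. 1 / \<bar>A2\<bar>) has_real_derivative 2 * (profile_twist_momentum t * m' t)) (at t)"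
    by (rule has_field_derivative_transform_within_open[OF _ I_open t]) (simp add: m2)
  then have "2 * (profile_twist_momentum t * m' t) = 0"
    by (rule DERIV_unique) simp
  moreover have "profile_twist_momentum t \<noteq> 0" using m2[OF t] A2 by auto
  ultimately show m0: "m' t = 0" by simp
  have "((\<lambda>t. - 8 * B1 * profile_twist_momentum t) has_real_derivative - 8 * B1 * m' t) (at t)"
    by (rule DERIV_cmult[OF m'[OF t]])
  moreover have "- 8 * B1 * profile_twist_momentum t = profile_shear_momentum t" if t: "t \<in> I" for t
  proof -
    have "1 - t ^ 4 = (1 - t\<^sup>2) * (1 + t\<^sup>2)" by (simp add: power2_eq_square power4_eq_xxxx algebra_simps)
    then show ?thesis
      unfolding profile_shear_momentum_def profile_twist_momentum_def u[OF t] using pos[OF t] one_plus_sq[of t]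
      by (simp add: power2_eq_square)
  qed
  ultimately have "(profile_shear_momentum has_real_derivative - 8 * B1 * m' t) (at t)"
    by (rule has_field_derivative_transform_within_open[OF _ I_open t])
  then show "(profile_shear_momentum has_real_derivative 0) (at t)" using m0 by simp
qed

text \<open>
  Where \<open>m'\<close> does not vanish, \<open>q\<close> vanishes on an open set, so \<open>\<Delta> = - (p' - p / t)\<^sup>2 / 4\<close> and
  \<open>w\<^sup>2 (p' - p / t)\<^sup>2 = 4\<close> there; the constant \<open>N\<^sup>2\<close> would be \<open>64 (t / (1 + t\<^sup>2))\<^sup>4\<close>.
\<close>

lemma twist_momentum_derivative_eq_0:
  assumes N0: "\<And>t. t \<in> I \<Longrightarrow> (profile_shear_momentum has_real_derivative 0) (at t)"
    and cm': "continuous_on I m'" and m'q: "\<And>t. t \<in> I \<Longrightarrow> m' t * q t = 0" and t0: "t0 \<in> I"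
  shows "m' t0 = 0"
proof (rule ccontr)
  assume nz: "m' t0 \<noteq> 0"
  define J where "J = {t \<in> I. m' t \<noteq> 0}"
  have oJ: "open J"
  proof -
    have "J = I \<inter> m' -` (- {0})" by (auto simp: J_def)
    then show ?thesis using continuous_open_preimage[OF cm' I_open, of "- {0}"] by auto
  qed
  have tJ: "t0 \<in> J" and JI: "J \<subseteq> I" using t0 nz by (auto simp: J_def)
  have q0: "q t = 0" if "t \<in> J" for t using m'q that by (auto simp: J_def)
  obtain c where c: "\<And>t. t \<in> I \<Longrightarrow> profile_shear_momentum t = c"
    using const_if_derivative_zero_on_interval[OF I_interval N0] by blast
  have h: "64 * (t / (1 + t\<^sup>2)) ^ 4 = c\<^sup>2" if t: "t \<in> J" for t
  proof -
    have tI: "t \<in> I" using t JI by auto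
    define u where "u = p' t - p t / t"
    have "\<Delta> t = - (u\<^sup>2 / 4)" unfolding radial_disc_def u_def using q0[OF t] by simp
    then have "(w t)\<^sup>2 * u\<^sup>2 = 4" using w_sq[OF tI] by simp
    moreover have "(profile_shear_momentum t)\<^sup>2 = (t\<^sup>2 * (4 / (1 + t\<^sup>2)\<^sup>2))\<^sup>2 * ((w t)\<^sup>2 * u\<^sup>2)"
      unfolding profile_shear_momentum_def u_def[symmetric] by (simp only: power_mult_distrib mult.assoc)
    ultimately show ?thesis
      using c[OF tI] by (simp add: power_mult_distrib power_divide)
  qed
  obtain t where t: "t \<in> J" "t / (1 + t\<^sup>2) \<noteq> t0 / (1 + t0\<^sup>2)"
    using radial_ratio_not_constant[OF oJ tJ] JI I_pos by blast
  have "(t / (1 + t\<^sup>2)) ^ 4 = (t0 / (1 + t0\<^sup>2)) ^ 4"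
    using h[OF t(1)] h[OF tJ] by simp
  moreover have "t / (1 + t\<^sup>2) > 0" "t0 / (1 + t0\<^sup>2) > 0"
    using pos t(1) tJ JI one_plus_sq by auto
  ultimately have "t / (1 + t\<^sup>2) = t0 / (1 + t0\<^sup>2)"
    by (metis less_imp_le power_eq_imp_eq_base zero_less_numeral)
  with t show False by simp
qed

text \<open>
  The constant value of \<open>m\<close> gives \<open>w\<close> and \<open>\<Delta>\<close>; then the constant value of \<open>N\<close> gives \<open>(p / t)'\<close>,
  and the expression for \<open>\<Delta>\<close> gives the derivative of \<open>(q / (1 + t\<^sup>2))\<^sup>2\<close>.
\<close>

lemma solution_if_momenta_constant:
  assumes N0: "\<And>t. t \<in> I \<Longrightarrow> (profile_shear_momentum has_real_derivative 0) (at t)"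
    and m0: "\<And>t. t \<in> I \<Longrightarrow> (profile_twist_momentum has_real_derivative 0) (at t)" and cw: "continuous_on I w"
  obtains A1 A2 B1 B2 \<epsilon> where "A2 \<noteq> 0" "\<epsilon> \<in> {1, - 1}" "solution A1 A2 B1 B2 \<epsilon>"
proof -
  obtain c1 where c1: "\<And>t. t \<in> I \<Longrightarrow> profile_shear_momentum t = c1"
    using const_if_derivative_zero_on_interval[OF I_interval N0] by blast
  obtain c2 where c2: "\<And>t. t \<in> I \<Longrightarrow> profile_twist_momentum t = c2"
    using const_if_derivative_zero_on_interval[OF I_interval m0] by blast
  obtain t0 where t0: "t0 \<in> I" using I_nonempty by blast
  \<comment> \<open>\<open>m = 0\<close> is possible only at \<open>t = 1\<close>, whereas the set of radii is open.\<close>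
  have c20: "c2 \<noteq> 0"
  proof
    assume "c2 = 0"
    have t1: "t = 1" if "t \<in> I" for t
    proof -
      have "(1 - t\<^sup>2) / (1 + t\<^sup>2) = 0"
        using c2[OF that] w_nonzero[OF that] \<open>c2 = 0\<close> by (simp add: profile_twist_momentum_def)
      then have "t\<^sup>2 = 1" using one_plus_sq[of t] by simp
      then show ?thesis using pos[OF that] by (simp add: power2_eq_1_iff)
    qed
    obtain t where "t \<in> I" "t / (1 + t\<^sup>2) \<noteq> t0 / (1 + t0\<^sup>2)"
      using radial_ratio_not_constant[OF I_open t0 I_pos] by blast
    then show False using t1[of t] t1[OF t0] by simp
  qed
  have n1: "1 - t\<^sup>2 \<noteq> 0" if "t \<in> I" for t
    using c2[OF that] c20 by (auto simp: profile_twist_momentum_def)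
  have wt: "w t = c2 * (1 + t\<^sup>2) / (1 - t\<^sup>2)" if t: "t \<in> I" for t
    using c2[OF t] n1[OF t] one_plus_sq[of t] by (simp add: profile_twist_momentum_def field_simps)
  define s where "s = sgn (w t0)"
  have sw: "sgn (w t) = s" if "t \<in> I" for t
    unfolding s_def by (rule sgn_const_on_interval[OF I_interval cw w_nonzero that t0])
  have s: "\<bar>s\<bar> = 1" using w_nonzero[OF t0] by (simp add: s_def sgn_if)
  \<comment> \<open>\<open>s\<close> is the constant sign of \<open>\<Delta>\<close>, and \<open>|\<Delta>| = w\<^bsup>-2\<^esup>\<close> with \<open>w\<close> from \<open>wt\<close>; \<open>B1\<close> is read off from \<open>N = c1\<close>.\<close>
  define A2 where "A2 = s / c2\<^sup>2"
  define B1 where "B1 = - c1 / (8 * c2)"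
  have A2: "A2 \<noteq> 0" using s c20 by (auto simp: A2_def)
  have \<Delta>: "\<Delta> t = A2 * ((1 - t\<^sup>2) / (1 + t\<^sup>2))\<^sup>2" if t: "t \<in> I" for t
  proof -
    have "\<bar>\<Delta> t\<bar> = 1 / (w t)\<^sup>2"
      using w_sq[OF t] w_nonzero[OF t] by (simp add: field_simps)
    moreover have "\<Delta> t = s * \<bar>\<Delta> t\<bar>"
      using sgn_w[OF t] sw[OF t] by (metis mult.commute mult_sgn_abs)
    ultimately have "\<Delta> t = s / (w t)\<^sup>2" by simp
    then show ?thesis
      unfolding wt[OF t] A2_def by (simp add: power_divide power_mult_distrib)
  qed
  have u: "p' t - p t / t = - 2 * B1 * (1 - t\<^sup>2) * (1 + t\<^sup>2) / t\<^sup>2" if t: "t \<in> I" for t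
  proof -
    define U S k where "U = p' t - p t / t" and "S = 1 + t\<^sup>2" and "k = 1 - t\<^sup>2"
    have S0: "S \<noteq> 0" and k0: "k \<noteq> 0" using one_plus_sq[of t] n1[OF t] by (simp_all add: S_def k_def)
    have "t\<^sup>2 * (4 / S\<^sup>2) * (c2 * S / k) * U = c1"
      using c1[OF t] by (simp add: profile_shear_momentum_def wt[OF t] U_def S_def k_def)
    moreover have "t\<^sup>2 * (4 / S\<^sup>2) * (c2 * S / k) * U = 4 * c2 * t\<^sup>2 * U / (k * S)"
      using S0 by (simp add: power2_eq_square mult_ac)
    ultimately have "4 * c2 * t\<^sup>2 * U = c1 * (k * S)"
      using S0 k0 by (simp add: field_simps)
    then have "U = - 2 * B1 * k * S / t\<^sup>2"
      using pos[OF t] c20 by (simp add: B1_def field_simps)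
    then show ?thesis by (simp add: U_def S_def k_def)
  qed
  have dA1: "((\<lambda>t. p t / t - B1 * ((1 + t\<^sup>2)\<^sup>2 / t\<^sup>2)) has_real_derivative 0) (at t)" if t: "t \<in> I" for t
  proof -
    have "((\<lambda>t. (1 + t\<^sup>2)\<^sup>2 / t\<^sup>2) has_real_derivative - 2 * (1 - t\<^sup>2) * (1 + t\<^sup>2) / t ^ 3) (at t)"
      using pos[OF t]
      by (auto intro!: derivative_eq_intros simp: divide_simps) (simp add: power2_eq_square power3_eq_cube power4_eq_xxxx algebra_simps)
    from DERIV_cmult[OF this, of B1]
    have 1: "((\<lambda>t. B1 * ((1 + t\<^sup>2)\<^sup>2 / t\<^sup>2)) has_real_derivative B1 * (- 2 * (1 - t\<^sup>2) * (1 + t\<^sup>2) / t ^ 3)) (at t)" .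
    have 2: "((\<lambda>t. p t / t) has_real_derivative (p' t - p t / t) / t) (at t)"
      using pos[OF t] p'[OF t] by (auto intro!: derivative_eq_intros simp: field_simps)
    show "((\<lambda>t. p t / t - B1 * ((1 + t\<^sup>2)\<^sup>2 / t\<^sup>2)) has_real_derivative 0) (at t)"
    proof -
      have "(p' t - p t / t) / t = B1 * (- 2 * (1 - t\<^sup>2) * (1 + t\<^sup>2) / t ^ 3)"
      proof -
        define k where "k = 1 - t\<^sup>2"
        show ?thesis
          unfolding u[OF t] k_def[symmetric] by (simp add: power2_eq_square power3_eq_cube mult_ac)
      qed
      then show ?thesis using DERIV_diff[OF 2 1] by (simp only: diff_self)
    qed
  qed
  obtain A1 where A1: "p t / t - B1 * ((1 + t\<^sup>2)\<^sup>2 / t\<^sup>2) = A1" if "t \<in> I" for t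
    using const_if_derivative_zero_on_interval[OF I_interval dA1] by blast
  have qq: "q t * (q' t - 2 * t * q t / (1 + t\<^sup>2)) = (1 - t\<^sup>2) * (A2 * t / (1 + t\<^sup>2) + B1\<^sup>2 * (1 + t\<^sup>2) ^ 3 / t ^ 3)"
    if t: "t \<in> I" for t
  proof -
    define S k x where "S = 1 + t\<^sup>2" and "k = 1 - t\<^sup>2" and "x = q t * (q' t - 2 * t * q t / (1 + t\<^sup>2))"
    have nz: "S \<noteq> 0" "k \<noteq> 0" "t \<noteq> 0" using one_plus_sq[of t] n1[OF t] pos[OF t] by (auto simp: S_def k_def)
    have "\<Delta> t = k / (t * S) * x - (- 2 * B1 * k * S / t\<^sup>2)\<^sup>2 / 4"
      unfolding radial_disc_def u[OF t] by (simp add: S_def k_def x_def)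
    then have "k / (t * S) * x = A2 * (k / S)\<^sup>2 + (- 2 * B1 * k * S / t\<^sup>2)\<^sup>2 / 4"
      using \<Delta>[OF t] by (simp add: S_def k_def)
    also have "\<dots> = k / (t * S) * (k * (A2 * t / S + B1\<^sup>2 * S ^ 3 / t ^ 3))"
      using nz by (simp add: field_simps power2_eq_square power3_eq_cube)
    finally have "x = k * (A2 * t / S + B1\<^sup>2 * S ^ 3 / t ^ 3)"
      using nz by simp
    then show ?thesis by (simp add: S_def k_def x_def)
  qed
  have dB2: "((\<lambda>t. (q t / (1 + t\<^sup>2))\<^sup>2 - (A2 * (t / (1 + t\<^sup>2))\<^sup>2 - B1\<^sup>2 * ((1 + t\<^sup>2) / t)\<^sup>2)) has_real_derivative 0) (at t)" if t: "t \<in> I" for t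
  proof -
    have t0: "t \<noteq> 0" and S0: "1 + t\<^sup>2 \<noteq> 0" using pos[OF t] one_plus_sq[of t] by auto
    have d1: "((\<lambda>t. t / (1 + t\<^sup>2)) has_real_derivative (1 - t\<^sup>2) / (1 + t\<^sup>2)\<^sup>2) (at t)"
      using S0 by (auto intro!: derivative_eq_intros simp: power2_eq_square)
    have d2: "((\<lambda>t. (1 + t\<^sup>2) / t) has_real_derivative - (1 - t\<^sup>2) / t\<^sup>2) (at t)"
      using t0 by (auto intro!: derivative_eq_intros simp: power2_eq_square field_simps)
    have d3: "((\<lambda>t. q t / (1 + t\<^sup>2)) has_real_derivative (q' t - 2 * t * q t / (1 + t\<^sup>2)) / (1 + t\<^sup>2)) (at t)"
      using S0 q'[OF t] by (auto intro!: derivative_eq_intros simp: field_simps power2_eq_square)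
    have sq: "((\<lambda>t. (f t)\<^sup>2) has_real_derivative 2 * f t * D) (at t)"
      if "(f has_real_derivative D) (at t)" for f D
      using that by (auto intro!: derivative_eq_intros)
    define S k where "S = 1 + t\<^sup>2" and "k = 1 - t\<^sup>2"
    have "((\<lambda>t. (q t / (1 + t\<^sup>2))\<^sup>2 - (A2 * (t / (1 + t\<^sup>2))\<^sup>2 - B1\<^sup>2 * ((1 + t\<^sup>2) / t)\<^sup>2)) has_real_derivative
       2 * (q t / S) * ((q' t - 2 * t * q t / S) / S) - (A2 * (2 * (t / S) * (k / S\<^sup>2)) - B1\<^sup>2 * (2 * (S / t) * (- k / t\<^sup>2)))) (at t)"
      unfolding S_def k_def
      by (rule DERIV_diff[OF sq[OF d3] DERIV_diff[OF DERIV_cmult[OF sq[OF d1]] DERIV_cmult[OF sq[OF d2]]]])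
    moreover have "2 * (q t / S) * ((q' t - 2 * t * q t / S) / S) = 2 * (q t * (q' t - 2 * t * q t / S)) / S\<^sup>2"
      by (simp add: power2_eq_square)
    moreover have "\<dots> = 2 * (k * (A2 * t / S + B1\<^sup>2 * S ^ 3 / t ^ 3)) / S\<^sup>2"
      using qq[OF t] by (simp add: S_def k_def)
    moreover have "\<dots> - (A2 * (2 * (t / S) * (k / S\<^sup>2)) - B1\<^sup>2 * (2 * (S / t) * (- k / t\<^sup>2))) = 0"
      using t0 S0[folded S_def] by (simp add: field_simps power2_eq_square power3_eq_cube)
    ultimately show "((\<lambda>t. (q t / (1 + t\<^sup>2))\<^sup>2 - (A2 * (t / (1 + t\<^sup>2))\<^sup>2 - B1\<^sup>2 * ((1 + t\<^sup>2) / t)\<^sup>2)) has_real_derivative 0) (at t)"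
      by simp
  qed
  obtain B2 where B2: "(q t / (1 + t\<^sup>2))\<^sup>2 - (A2 * (t / (1 + t\<^sup>2))\<^sup>2 - B1\<^sup>2 * ((1 + t\<^sup>2) / t)\<^sup>2) = B2" if "t \<in> I" for t
    using const_if_derivative_zero_on_interval[OF I_interval dB2] by blast
  define D where "D t = A2 * t\<^sup>2 + B2 * (1 + t\<^sup>2)\<^sup>2 - B1\<^sup>2 * (1 + t\<^sup>2) ^ 4 / t\<^sup>2" for t
  have qD: "(q t)\<^sup>2 = D t" if t: "t \<in> I" for t
  proof -
    define S where "S = 1 + t\<^sup>2"
    have S0: "S \<noteq> 0" using one_plus_sq[of t] by (simp add: S_def)
    have qS: "(q t / S)\<^sup>2 = B2 + A2 * (t / S)\<^sup>2 - B1\<^sup>2 * (S / t)\<^sup>2"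
      using B2[OF t] by (simp add: S_def)
    have "(q t)\<^sup>2 = (q t / S)\<^sup>2 * S\<^sup>2"
      using S0 by (simp add: power_divide)
    also have "\<dots> = (B2 + A2 * (t / S)\<^sup>2 - B1\<^sup>2 * (S / t)\<^sup>2) * S\<^sup>2"
      by (simp only: qS)
    also have "\<dots> = A2 * t\<^sup>2 + B2 * S\<^sup>2 - B1\<^sup>2 * S ^ 4 / t\<^sup>2"
      using S0 pos[OF t] by (simp add: field_simps power2_eq_square power4_eq_xxxx)
    finally show ?thesis by (simp add: D_def S_def)
  qed
  \<comment> \<open>In the variable \<open>r = (t / (1 + t\<^sup>2))\<^sup>2\<close> the function \<open>r (q / (1 + t\<^sup>2))\<^sup>2\<close> is the quadratic polynomial
    \<open>A2 r\<^sup>2 + B2 r - B1\<^sup>2\<close>. At a zero of \<open>q\<close> the formula for \<open>\<Delta>\<close> forces a double root with \<open>A2 < 0\<close>,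
    so the polynomial would be negative at the neighbouring radii.\<close>
  have q_nonzero: "q t \<noteq> 0" if t: "t \<in> I" for t
  proof
    assume q0: "q t = 0"
    define r where "r t = (t / (1 + t\<^sup>2))\<^sup>2" for t :: real
    have r0: "r t > 0" if "t \<in> I" for t
      using pos[OF that] one_plus_sq[of t] by (simp add: r_def)
    have T: "A2 * (r x)\<^sup>2 + B2 * r x - B1\<^sup>2 = r x * (q x / (1 + x\<^sup>2))\<^sup>2" if "x \<in> I" for x
    proof -
      have "B1\<^sup>2 * ((1 + x\<^sup>2) / x)\<^sup>2 = B1\<^sup>2 / r x"
        by (simp add: r_def power_divide)
      then have "(q x / (1 + x\<^sup>2))\<^sup>2 = B2 + A2 * r x - B1\<^sup>2 / r x"
        using B2[OF that] by (simp add: r_def)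
      then show ?thesis
        using r0[OF that] by (simp add: field_simps power2_eq_square)
    qed
    have "(A2 * t / (1 + t\<^sup>2) + B1\<^sup>2 * (1 + t\<^sup>2) ^ 3 / t ^ 3) = 0"
      using qq[OF t] q0 n1[OF t] by simp
    moreover have "A2 * t / (1 + t\<^sup>2) + B1\<^sup>2 * (1 + t\<^sup>2) ^ 3 / t ^ 3 = (A2 * (r t)\<^sup>2 + B1\<^sup>2) * ((1 + t\<^sup>2) ^ 3 / t ^ 3)"
    proof -
      define S where "S = 1 + t\<^sup>2"
      have "S \<noteq> 0" "t \<noteq> 0" using one_plus_sq[of t] pos[OF t] by (auto simp: S_def)
      then show ?thesis unfolding r_def S_def[symmetric]
        by (simp add: field_simps power2_eq_square power3_eq_cube)
    qed
    moreover have "(1 + t\<^sup>2) ^ 3 / t ^ 3 \<noteq> 0" using one_plus_sq[of t] pos[OF t] by simp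
    ultimately have B1r: "B1\<^sup>2 = - A2 * (r t)\<^sup>2" by simp
    then have A2neg: "A2 < 0"
      using A2 r0[OF t] zero_le_power2[of B1] by (auto simp: zero_le_mult_iff mult_le_0_iff)
    have "B2 * r t = (- 2 * A2 * r t) * r t"
      using T[OF t] q0 B1r by (simp add: power2_eq_square)
    then have B2r: "B2 = - 2 * A2 * r t"
      using r0[OF t] unfolding mult_cancel_right by simp
    have const: "r x = r t" if "x \<in> I" for x
    proof -
      have "A2 * (r x - r t)\<^sup>2 \<ge> 0"
      proof -
        have "A2 * (r x - r t)\<^sup>2 = A2 * (r x)\<^sup>2 + B2 * r x - B1\<^sup>2"
          unfolding B1r B2r by (simp add: power2_eq_square algebra_simps)
        then show ?thesis unfolding T[OF that] using r0[OF that] by simp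
      qed
      then show ?thesis using A2neg by (simp add: zero_le_mult_iff)
    qed
    obtain x where x: "x \<in> I" "x / (1 + x\<^sup>2) \<noteq> t / (1 + t\<^sup>2)"
      using radial_ratio_not_constant[OF I_open t I_pos] by blast
    have "x / (1 + x\<^sup>2) > 0" "t / (1 + t\<^sup>2) > 0"
      using pos x(1) t one_plus_sq by auto
    with const[OF x(1)] have "x / (1 + x\<^sup>2) = t / (1 + t\<^sup>2)"
      unfolding r_def by (metis less_imp_le power_eq_imp_eq_base zero_less_numeral)
    with x show False by simp
  qed
  have cq: "continuous_on I q"
    using q' by (intro continuous_at_imp_continuous_on ballI DERIV_isCont)
  define \<epsilon> where "\<epsilon> = sgn (q t0)"
  have \<epsilon>: "\<epsilon> \<in> {1, - 1}" using q_nonzero[OF t0] by (auto simp: \<epsilon>_def sgn_if)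
  have "solution A1 A2 B1 B2 \<epsilon>"
    unfolding solution_def Let_def D_def[symmetric]
  proof (intro ballI conjI)
    fix t assume t: "t \<in> I"
    show "0 \<le> D t" using qD[OF t] by (metis zero_le_power2)
    show "p t = A1 * t + B1 * (1 + t\<^sup>2)\<^sup>2 / t"
    proof -
      have "p t / t = A1 + B1 * ((1 + t\<^sup>2)\<^sup>2 / t\<^sup>2)" using A1[OF t] by simp
      then have "p t = (A1 + B1 * ((1 + t\<^sup>2)\<^sup>2 / t\<^sup>2)) * t" using pos[OF t] by (simp add: field_simps)
      then show ?thesis using pos[OF t] by (simp add: distrib_right power2_eq_square)
    qed
    have "sgn (q t) = \<epsilon>"
      unfolding \<epsilon>_def by (rule sgn_const_on_interval[OF I_interval cq q_nonzero t t0])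
    then show "q t = \<epsilon> * sqrt (D t)"
      using qD[OF t] by (metis mult_sgn_abs mult.commute real_sqrt_abs)
  qed
  then show ?thesis using that A2 \<epsilon> by blast
qed

end

section \<open>Classification of area-stationary rotationally symmetric graphs\<close>

theorem theorem3:
  fixes F :: "complex \<Rightarrow> complex" and U :: "complex set"
  assumes "open U" and "connected U"
    and "smooth_on F U"
    and "rotationally_symmetric (graph F U)"
    and "nondegenerate_graph F U"
  shows "area_stationary F U \<longleftrightarrow>
    (\<exists>A\<^sub>1 A\<^sub>2 B\<^sub>1 B\<^sub>2 :: real. \<exists>\<epsilon>\<in>{1, -1 :: real}. A\<^sub>2 \<noteq> 0 \<and>
      (\<forall>R \<theta>. R > 0 \<and> rcis R \<theta> \<in> U \<longrightarrow>
        (let D = A\<^sub>2 * R\<^sup>2 + B\<^sub>2 * (1 + R\<^sup>2)\<^sup>2 - B\<^sub>1\<^sup>2 * (1 + R\<^sup>2) ^ 4 / R\<^sup>2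
         in D \<ge> 0 \<and>
            F (rcis R \<theta>) =
              (complex_of_real (A\<^sub>1 * R + B\<^sub>1 * (1 + R\<^sup>2)\<^sup>2 / R)
               + \<i> * complex_of_real (\<epsilon> * sqrt D)) * cis \<theta>)))"
    (is "_ \<longleftrightarrow> (\<exists>A1 A2 B1 B2. \<exists>\<epsilon>\<in>{1, -1}. A2 \<noteq> 0 \<and> ?formula A1 A2 B1 B2 \<epsilon>)")
proof -
  note rot = rotationally_symmetric_graphD[OF assms(4)]
  have F: "Ck_on 2 F U" using assms(3) by (simp only: smooth_on_def)
  note ctx = assms(1) rot(1) F assms(5) rot(2)
  have stationary: "area_stationary F U \<longleftrightarrow> (\<forall>t\<in>radii U. euler_lagrange F (complex_of_real t) = 0)"
    using area_stationary_iff_euler_lagrange[OF assms(1) F assms(5)] euler_lagrange_iff_radial[OF ctx] by simp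
  show ?thesis
  proof (cases "radii U = {}")
    case True
    then have "\<not> (R > 0 \<and> rcis R \<theta> \<in> U)" for R \<theta>
      using rotate_mem_iff[OF rot(1)] by (auto simp: radii_def rcis_def)
    \<comment> \<open>Here \<open>U\<close> has no point except possibly 0, and any constants with \<open>A\<^sub>2 \<noteq> 0\<close> will do.\<close>
    then have "?formula 0 1 0 0 1" by blast
    moreover have "(1::real) \<noteq> 0" "(1::real) \<in> {1, -1}" by simp_all
    ultimately show ?thesis
      using stationary True by blast
  next
    case False
    define p q where "p t = Re (F (complex_of_real t))" and "q t = Im (F (complex_of_real t))" for t
    define p' q' where "p' t = Re (radial_derivative F t)" and "q' t = Im (radial_derivative F t)" for t
    define w where "w t = inv_sqrt_disc F (complex_of_real t)" for t
    have U: "complex_of_real t \<in> U" "t > 0" if "t \<in> radii U" for t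
      using that by (auto simp: radii_def)
    have disc: "radial_disc p p' q q' t = disc F (complex_of_real t)" if "t \<in> radii U" for t
      unfolding radial_disc_def disc_radial[OF ctx that] p_def q_def p'_def q'_def by simp
    interpret radial_profile "radii U" p p' q q' w
    proof
      show "open (radii U)" by (rule open_radii[OF assms(1)])
      show "is_interval (radii U)" by (rule is_interval_radii[OF assms(2) rot(1)])
      show "radii U \<subseteq> {0<..}" using U(2) by auto
      show "radii U \<noteq> {}" by (rule False)
    next
      fix t assume t: "t \<in> radii U"
      have dF: "F differentiable (at (complex_of_real t))"
        using Ck_on_2D(2)[OF F] U(1)[OF t] by simp
      show "(p has_real_derivative p' t) (at t)" "(q has_real_derivative q' t) (at t)"
        unfolding p_def p'_def q_def q'_def radial_derivative_def
        by (rule has_real_derivative_on_real_axis[OF dF])+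
      show "radial_disc p p' q q' t \<noteq> 0"
        unfolding disc[OF t] by (rule disc_nonzero[OF Ck_on_2D(1)[OF F] assms(5) U(1)[OF t]])
      show "w t = sgn (radial_disc p p' q q' t) / sqrt \<bar>radial_disc p p' q q' t\<bar>"
        unfolding disc[OF t] w_def inv_sqrt_disc_def ..
    qed
    have profile_shear_momentum: "profile_shear_momentum = shear_momentum F" and profile_twist_momentum: "profile_twist_momentum = twist_momentum F"
      by (simp_all add: fun_eq_iff profile_shear_momentum_def profile_twist_momentum_def shear_momentum_def twist_momentum_def p_def p'_def w_def)
    obtain m' where m': "continuous_on (radii U) m'"
      "\<And>t. t \<in> radii U \<Longrightarrow> (profile_twist_momentum has_real_derivative m' t) (at t)"
      using twist_momentum_C1[OF ctx] unfolding profile_twist_momentum by blast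
    have EL: "euler_lagrange F (complex_of_real t) = 0 \<longleftrightarrow> (profile_shear_momentum has_real_derivative 0) (at t) \<and> m' t * q t = 0"
      if "t \<in> radii U" for t
      using radial_euler_lagrange(1)[OF ctx that m'(2)[OF that, unfolded profile_twist_momentum]] unfolding profile_shear_momentum q_def .
    have cw: "continuous_on (radii U) w"
      unfolding w_def using DERIV_isCont[OF inv_sqrt_disc_radial_derivative[OF ctx]]
      by (intro continuous_at_imp_continuous_on) auto
    have formula: "?formula A1 A2 B1 B2 \<epsilon> \<longleftrightarrow> solution A1 A2 B1 B2 \<epsilon>" for A1 A2 B1 B2 \<epsilon>
    proof
      assume f: "?formula A1 A2 B1 B2 \<epsilon>"
      show "solution A1 A2 B1 B2 \<epsilon>"
        unfolding solution_def
      proof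
        fix t assume t: "t \<in> radii U"
        \<comment> \<open>On the real axis, \<open>\<theta> = 0\<close>, real and imaginary part can be compared.\<close>
        with U[OF t] f[rule_format, of t 0]
        show "let D = A2 * t\<^sup>2 + B2 * (1 + t\<^sup>2)\<^sup>2 - B1\<^sup>2 * (1 + t\<^sup>2) ^ 4 / t\<^sup>2
          in D \<ge> 0 \<and> p t = A1 * t + B1 * (1 + t\<^sup>2)\<^sup>2 / t \<and> q t = \<epsilon> * sqrt D"
          by (simp add: Let_def rcis_def p_def q_def del: of_real_add of_real_mult of_real_divide of_real_diff of_real_power)
      qed
    next
      assume s: "solution A1 A2 B1 B2 \<epsilon>"
      show "?formula A1 A2 B1 B2 \<epsilon>"
      proof (intro allI impI)
        fix R \<theta> assume R: "R > 0 \<and> rcis R \<theta> \<in> U"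
        then have t: "R \<in> radii U"
          using rotate_mem_iff[OF rot(1)] by (auto simp: radii_def rcis_def)
        have "F (rcis R \<theta>) = (complex_of_real (p R) + \<i> * complex_of_real (q R)) * cis \<theta>"
          using equivariantD[OF rot(2) U(1)[OF t], of \<theta>] complex_eq[of "F (complex_of_real R)"]
          by (simp add: rcis_def p_def q_def mult.commute)
        then show "let D = A2 * R\<^sup>2 + B2 * (1 + R\<^sup>2)\<^sup>2 - B1\<^sup>2 * (1 + R\<^sup>2) ^ 4 / R\<^sup>2
          in D \<ge> 0 \<and> F (rcis R \<theta>) = (complex_of_real (A1 * R + B1 * (1 + R\<^sup>2)\<^sup>2 / R)
               + \<i> * complex_of_real (\<epsilon> * sqrt D)) * cis \<theta>"
          using s t unfolding solution_def Let_def by metis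
      qed
    qed
    show ?thesis
      unfolding formula stationary
    proof
      assume el: "\<forall>t\<in>radii U. euler_lagrange F (complex_of_real t) = 0"
      have N0: "(profile_shear_momentum has_real_derivative 0) (at t)" and mq: "m' t * q t = 0" if "t \<in> radii U" for t
        using el EL[OF that] that by auto
      have "(profile_twist_momentum has_real_derivative 0) (at t)" if "t \<in> radii U" for t
        using m'(2)[OF that] twist_momentum_derivative_eq_0[OF N0 m'(1) mq that] by simp
      from solution_if_momenta_constant[OF N0 this cw]
      show "\<exists>A1 A2 B1 B2. \<exists>\<epsilon>\<in>{1, -1}. A2 \<noteq> 0 \<and> solution A1 A2 B1 B2 \<epsilon>"
        by metis
    next
      assume "\<exists>A1 A2 B1 B2. \<exists>\<epsilon>\<in>{1, -1}. A2 \<noteq> 0 \<and> solution A1 A2 B1 B2 \<epsilon>"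
      then obtain A1 A2 B1 B2 \<epsilon> where "\<epsilon> \<in> {1, -1}" "A2 \<noteq> 0" "solution A1 A2 B1 B2 \<epsilon>"
        by blast
      then show "\<forall>t\<in>radii U. euler_lagrange F (complex_of_real t) = 0"
        using EL momenta_constant_if_solution[OF _ _ _ m'(2)] by simp
    qed
  qed
qed

end
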